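(* Let $\alpha>-1$ and let $f:\mathbb{D}\to\mathbb{D}$ be an $\alpha$-harmonic function. Then for all $z\in\mathbb{D}$: (1) If $\alpha\ge0$, then $$\left|f(z)-\frac{(1-|z|^2)^{\alpha+1}}{1+|z|^2}f(0)\right|\le\frac{2^{\alpha+2}}{\pi}\arctan|z|+2^{\alpha+1}(1-|z|)\left(1-(1-|z|)^\alpha\right).$$ (2) If $\alpha<0$, then $$\left|f(z)-\frac{(1-|z|^2)^{\alpha+1}}{1+|z|^2}f(0)\right|\le\frac4\pi(1-|z|)^\alpha\arctan|z|+\left((1-|z|)^\alpha-1\right).$$
   Context: $\mathbb{D}$ is the open unit disk in $\mathbb{C}$. For $z=x+iy$, $\partial_z f=\frac12(f_x-if_y)$ and $\overline{\partial}_z f=\frac12(f_x+if_y)$. For $\alpha>-1$, a function $f\in C^2(\mathbb{D})$ (complex-valued) is $\alpha$-harmonic if $\partial_z\big((1-|z|^2)^{-\alpha}\,\overline{\partial}_z f\big)=0$ in $\mathbb{D}$. *)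

theory Defs
  imports "HOL-Analysis.Analysis"
begin

definition partial_x :: "(complex \<Rightarrow> complex) \<Rightarrow> complex \<Rightarrow> complex" where
  "partial_x f z = vector_derivative (\<lambda>t::real. f (z + of_real t)) (at 0)"

definition partial_y :: "(complex \<Rightarrow> complex) \<Rightarrow> complex \<Rightarrow> complex" where
  "partial_y f z = vector_derivative (\<lambda>t::real. f (z + \<i> * of_real t)) (at 0)"

text \<open>Real differentiability classes on an open set: all partial derivatives exist and are
  continuous. The existence clauses are needed because \<open>vector_derivative\<close> is total.\<close>

definition C1_on :: "complex set \<Rightarrow> (complex \<Rightarrow> complex) \<Rightarrow> bool" where
  "C1_on S f \<longleftrightarrow>
     (\<forall>z\<in>S. (\<lambda>t::real. f (z + of_real t)) differentiable (at 0) \<and>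
            (\<lambda>t::real. f (z + \<i> * of_real t)) differentiable (at 0)) \<and>
     continuous_on S (partial_x f) \<and> continuous_on S (partial_y f)"

definition C2_on :: "complex set \<Rightarrow> (complex \<Rightarrow> complex) \<Rightarrow> bool" where
  "C2_on S f \<longleftrightarrow> C1_on S f \<and> C1_on S (partial_x f) \<and> C1_on S (partial_y f)"

definition wirtinger :: "(complex \<Rightarrow> complex) \<Rightarrow> complex \<Rightarrow> complex" where
  "wirtinger f z = (partial_x f z - \<i> * partial_y f z) / 2"

definition wirtinger_bar :: "(complex \<Rightarrow> complex) \<Rightarrow> complex \<Rightarrow> complex" where
  "wirtinger_bar f z = (partial_x f z + \<i> * partial_y f z) / 2"

text \<open>Functions on the unit disk are total functions on \<open>complex\<close>; their values outside the disk
  are irrelevant, since the derivatives below are taken at points of the open disk only.\<close>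

definition alpha_harmonic :: "real \<Rightarrow> (complex \<Rightarrow> complex) \<Rightarrow> bool" where
  "alpha_harmonic \<alpha> f \<longleftrightarrow>
     C2_on (ball 0 1) f \<and>
     (\<forall>z\<in>ball 0 1.
        wirtinger (\<lambda>w. of_real ((1 - (cmod w)\<^sup>2) powr (-\<alpha>)) * wirtinger_bar f w) z = 0)"

end

theory Submission
  imports Defs "HOL-Complex_Analysis.Complex_Analysis"
begin

text \<open>
  The proof is the Poisson representation followed by an estimate of the kernel. Write
  \<open>x = |z|\<^sup>2\<close> and let \<open>c\<^sub>m\<close> be the Taylor coefficients of \<open>(1 - x)\<^bsup>-(\<alpha> + 1)\<^esup>\<close>.

  The equation says that \<open>(1 - |z|\<^sup>2)\<^bsup>-\<alpha>\<^esup>\<close> times the anti-holomorphic derivative of \<open>f\<close> is the conjugate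
  of a holomorphic function \<open>h\<close>. One solution of this first-order equation is an explicit integral of \<open>h\<close>
  along the segment from \<open>0\<close> to \<open>z\<close>, and two solutions differ by a holomorphic function. Expanding
  \<open>h\<close> in its Taylor series, \<open>f\<close> becomes a holomorphic function plus a series of the modes
  \<open>cnj z ^ m * R\<^sub>m(x)\<close> with \<open>R\<^sub>m(x) = \<integral>\<^sub>0\<^sup>1 t\<^bsup>m - 1\<^esup> (1 - t x)\<^sup>\<alpha> dt\<close> and \<open>m \<ge> 1\<close>
  (\<open>alpha_harmonic_has_expansion\<close>).

  Two descriptions of the same function make the kernel work on these modes. The normalised
  incomplete beta function \<open>S\<^sub>m(x) = m c\<^sub>m x\<^sup>m R\<^sub>m(x)\<close> is also
  \<open>(1 - x)\<^bsup>\<alpha> + 1\<^esup> \<Sum>\<^bsub>j \<ge> m\<^esub> c\<^sub>j x\<^sup>j\<close>, which is \<open>r\<^sup>m\<close> times the Fourier coefficient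
  of order \<open>m\<close> of the kernel at radius \<open>r = sqrt x\<close>. It lies in \<open>[0, 1]\<close> and tends to \<open>1\<close> at \<open>1\<close>.
  So the mean over the unit circle of the kernel at \<open>r\<close> against the dilate \<open>\<zeta> \<mapsto> f (\<rho> \<zeta>)\<close>
  converges to \<open>f r\<close> as \<open>\<rho>\<close> tends to \<open>1\<close> (\<open>expansion_poisson_limit\<close>). The dilates take the place of a
  boundary function of \<open>f\<close>.

  As the mean of \<open>\<zeta> \<mapsto> f (\<rho> \<zeta>)\<close> is \<open>f 0\<close> and \<open>|f| < 1\<close>, the quantity to be estimated is at most the mean of
  the modulus of the kernel minus the constant \<open>(1 - r\<^sup>2)\<^bsup>\<alpha> + 1\<^esup> / (1 + r\<^sup>2)\<close>. The kernel is
  \<open>(1 - r\<^sup>2)\<^sup>\<alpha> (1 - r \<zeta>)\<^bsup>-\<alpha>\<^esup>\<close> times the classical Poisson kernel. The classical kernel minus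
  \<open>(1 - r\<^sup>2) / (1 + r\<^sup>2)\<close> has the sign of the cosine, so that the mean of its modulus is exactly
  \<open>4 / \<pi> * arctan r\<close> (\<open>poisson_deviation_integral\<close>), and the distance of \<open>(1 - r \<zeta>)\<^bsup>-\<alpha>\<^esup>\<close> from \<open>1\<close>
  is largest at \<open>\<zeta> = 1\<close> (\<open>powr_minus_one_bound\<close>). The two cases of the theorem differ only in which of
  the two factors is replaced by its constant first.
\<close>

section \<open>Termwise integration and the tails of the binomial series\<close>

lemma sums_integral_Weierstrass:
  fixes u :: "nat \<Rightarrow> real \<Rightarrow> complex"
  assumes cont: "\<And>n. continuous_on {a..b} (u n)"
    and le: "\<And>n t. t \<in> {a..b} \<Longrightarrow> norm (u n t) \<le> M n"
    and M: "summable M"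
  shows "(\<lambda>n. integral {a..b} (u n)) sums integral {a..b} (\<lambda>t. \<Sum>n. u n t)"
proof -
  have "uniform_limit {a..b} (\<lambda>N t. \<Sum>n<N. u n t) (\<lambda>t. \<Sum>n. u n t) sequentially"
    by (rule Weierstrass_m_test[OF _ M]) (use le in auto)
  moreover have "continuous_on {a..b} (\<lambda>t. \<Sum>n<N. u n t)" for N
    using cont by (intro continuous_on_sum) auto
  ultimately obtain I J where I: "\<And>N. ((\<lambda>t. \<Sum>n<N. u n t) has_integral I N) {a..b}"
    and J: "((\<lambda>t. \<Sum>n. u n t) has_integral J) {a..b}" and IJ: "I \<longlonglongrightarrow> J"
    by (rule uniform_limit_integral) auto
  have "I N = (\<Sum>n<N. integral {a..b} (u n))" for N
    using I[of N] integral_sum[of "{..<N}" u "{a..b}"] cont integrable_continuous_interval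
    by (metis (no_types, lifting) finite_lessThan integral_unique)
  then have "I = (\<lambda>N. \<Sum>n<N. integral {a..b} (u n))" by auto
  with IJ show ?thesis
    by (simp add: sums_def integral_unique[OF J])
qed

text \<open>Taylor coefficients of \<open>(1 - z)\<^bsup>-(\<alpha> + 1)\<^esup>\<close>.\<close>

definition binom_coeff :: "real \<Rightarrow> nat \<Rightarrow> real" where
  "binom_coeff \<alpha> m = pochhammer (\<alpha> + 1) m / fact m"

lemma binom_coeff_0 [simp]: "binom_coeff \<alpha> 0 = 1"
  by (simp add: binom_coeff_def)

lemma binom_coeff_pos: "\<alpha> > -1 \<Longrightarrow> binom_coeff \<alpha> m > 0"
  by (simp add: binom_coeff_def pochhammer_pos)

lemma binom_coeff_Suc: "real (Suc m) * binom_coeff \<alpha> (Suc m) = (real m + \<alpha> + 1) * binom_coeff \<alpha> m"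
  by (simp add: binom_coeff_def pochhammer_Suc divide_simps)

lemma binom_coeff_sums:
  fixes z :: complex
  assumes "norm z < 1"
  shows "(\<lambda>m. of_real (binom_coeff \<alpha> m) * z ^ m) sums (1 - z) powr (- of_real (\<alpha> + 1))"
proof -
  have "((- of_real (\<alpha> + 1) :: complex) gchoose m) * (- z) ^ m = of_real (binom_coeff \<alpha> m) * z ^ m" for m
  proof -
    have "((- of_real (\<alpha> + 1) :: complex) gchoose m) * (- z) ^ m
        = of_real (binom_coeff \<alpha> m) * ((- 1) ^ m * (- z) ^ m)"
      by (simp only: gbinomial_pochhammer minus_minus pochhammer_of_real binom_coeff_def of_real_divide
          of_real_fact times_divide_eq_left times_divide_eq_right mult_ac)
    also have "(- 1) ^ m * (- z) ^ m = z ^ m"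
      by (simp flip: power_mult_distrib)
    finally show ?thesis .
  qed
  with gen_binomial_complex[of "- z" "- of_real (\<alpha> + 1)"] assms show ?thesis
    by simp
qed

text \<open>For \<open>0 \<le> x < 1\<close> this is \<open>(1 - x)\<^bsup>\<alpha> + 1\<^esup>\<close> times the part \<open>j \<ge> m\<close> of the binomial series of
  \<open>(1 - x)\<^bsup>-(\<alpha> + 1)\<^esup>\<close>, and for \<open>m \<ge> 1\<close> it is the regularised incomplete beta function with parameters
  \<open>m\<close> and \<open>\<alpha> + 1\<close>. The finite sum makes the limit at \<open>1\<close> and the bound by \<open>1\<close> immediate.\<close>

definition binom_tail :: "real \<Rightarrow> nat \<Rightarrow> real \<Rightarrow> real" where
  "binom_tail \<alpha> m x = 1 - (1 - x) powr (\<alpha> + 1) * (\<Sum>j<m. binom_coeff \<alpha> j * x ^ j)"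

text \<open>Raising \<open>m\<close> by one subtracts one term from the tail. In the derivative of that term the
  recursion of the coefficients makes everything collapse to a single monomial times \<open>(1 - x)\<^sup>\<alpha>\<close>.\<close>

lemma binom_tail_deriv:
  assumes "x < 1"
  shows "(binom_tail \<alpha> m has_real_derivative real m * binom_coeff \<alpha> m * x ^ (m - 1) * (1 - x) powr \<alpha>) (at x)"
proof (induction m)
  case 0
  show ?case by (simp add: binom_tail_def[abs_def])
next
  case (Suc m)
  have e: "binom_tail \<alpha> (Suc m) = (\<lambda>x. binom_tail \<alpha> m x - binom_coeff \<alpha> m * (x ^ m * (1 - x) powr (\<alpha> + 1)))"
    by (auto simp: binom_tail_def algebra_simps)
  have p: "(1 - x) powr (\<alpha> + 1) = (1 - x) * (1 - x) powr \<alpha>"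
    using assms by (simp add: powr_add)
  have "((\<lambda>x. x ^ m * (1 - x) powr (\<alpha> + 1)) has_real_derivative
     (real m * x ^ (m - 1)) * (1 - x) powr (\<alpha> + 1) - x ^ m * ((\<alpha> + 1) * (1 - x) powr \<alpha>)) (at x)"
    using assms by (auto intro!: derivative_eq_intros simp: algebra_simps)
  from DERIV_diff[OF Suc DERIV_cmult[OF this, of "binom_coeff \<alpha> m"]]
  have "(binom_tail \<alpha> (Suc m) has_real_derivative
     real m * binom_coeff \<alpha> m * x ^ (m - 1) * (1 - x) powr \<alpha> -
       binom_coeff \<alpha> m * ((real m * x ^ (m - 1)) * (1 - x) powr (\<alpha> + 1) - x ^ m * ((\<alpha> + 1) * (1 - x) powr \<alpha>))) (at x)"
    by (simp only: e)
  also have "real m * binom_coeff \<alpha> m * x ^ (m - 1) * (1 - x) powr \<alpha> -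
       binom_coeff \<alpha> m * ((real m * x ^ (m - 1)) * (1 - x) powr (\<alpha> + 1) - x ^ m * ((\<alpha> + 1) * (1 - x) powr \<alpha>))
     = ((real m + \<alpha> + 1) * binom_coeff \<alpha> m) * x ^ m * (1 - x) powr \<alpha>"
    unfolding p by (cases m) (auto simp: algebra_simps)
  also note binom_coeff_Suc[symmetric]
  finally show ?case by simp
qed

lemma binom_tail_at_0: "m > 0 \<Longrightarrow> binom_tail \<alpha> m 0 = 0"
proof -
  assume "m > 0"
  then obtain k where "m = Suc k" by (cases m) auto
  then show ?thesis by (simp add: binom_tail_def sum.lessThan_Suc_shift)
qed

lemma binom_tail_le_1:
  assumes "\<alpha> > -1" "x \<ge> 0"
  shows "binom_tail \<alpha> m x \<le> 1"
  unfolding binom_tail_def using assms binom_coeff_pos[of \<alpha>]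
  by (simp add: sum_nonneg less_imp_le)

text \<open>Here \<open>\<alpha> > -1\<close> enters: the power \<open>(1 - x)\<^bsup>\<alpha> + 1\<^esup>\<close> kills the polynomial factor at \<open>1\<close>.\<close>

lemma binom_tail_tendsto_1:
  assumes "\<alpha> > -1"
  shows "(binom_tail \<alpha> m \<longlongrightarrow> 1) (at_left 1)"
proof -
  have 0: "((\<lambda>x::real. (1 - x) powr (\<alpha> + 1)) \<longlongrightarrow> 0) (at_left 1)"
  proof -
    have "((\<lambda>x::real. (1 - x) powr (\<alpha> + 1)) \<longlongrightarrow> (1 - 1) powr (\<alpha> + 1)) (at_left 1)"
    proof (rule tendsto_powr')
      show "1 - 1 \<noteq> (0::real) \<or> 0 < \<alpha> + 1 \<and> (\<forall>\<^sub>F x::real in at_left 1. 0 \<le> 1 - x)"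
        using assms by (auto simp: eventually_at_filter)
    qed (intro tendsto_intros)+
    then show ?thesis by simp
  qed
  have "((\<lambda>x. 1 - (1 - x) powr (\<alpha> + 1) * (\<Sum>j<m. binom_coeff \<alpha> j * x ^ j)) \<longlongrightarrow>
      1 - 0 * (\<Sum>j<m. binom_coeff \<alpha> j * 1 ^ j)) (at_left (1::real))"
    by (intro tendsto_intros 0)
  then show ?thesis by (simp add: binom_tail_def[abs_def])
qed

text \<open>The radial factor of the mode of order \<open>Suc n\<close>: the index is shifted by one so that it agrees with the
  power of \<open>t\<close>.\<close>

definition radial :: "real \<Rightarrow> nat \<Rightarrow> real \<Rightarrow> real" where
  "radial \<alpha> n x = integral {0..1} (\<lambda>t. t ^ n * (1 - t * x) powr \<alpha>)"

lemma radial_integrand_continuous: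
  fixes x :: real
  assumes "0 \<le> x" "x < 1"
  shows "continuous_on {0..1} (\<lambda>t::real. (1 - t * x) powr \<alpha>)"
proof -
  have "1 - t * x \<noteq> 0" if "t \<in> {0..1}" for t
    using mult_left_le_one_le[of x t] that assms by (auto simp: mult.commute)
  then show ?thesis by (intro continuous_intros) auto
qed

text \<open>The right-hand side vanishes at \<open>0\<close>, and integrating its derivative along the segment from \<open>0\<close> to \<open>x\<close>
  gives the left-hand side.\<close>

lemma radial_tail:
  assumes "0 \<le> x" "x < 1"
  shows "real (Suc n) * binom_coeff \<alpha> (Suc n) * x ^ Suc n * radial \<alpha> n x = binom_tail \<alpha> (Suc n) x"
proof -
  define C where "C = real (Suc n) * binom_coeff \<alpha> (Suc n)"
  have "((\<lambda>t. C * x ^ Suc n * (t ^ n * (1 - t * x) powr \<alpha>)) has_integral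
      (binom_tail \<alpha> (Suc n) (1 * x) - binom_tail \<alpha> (Suc n) (0 * x))) {0..1}"
  proof (rule fundamental_theorem_of_calculus)
    fix t :: real assume t: "t \<in> {0..1}"
    then have "t * x < 1"
      using assms mult_left_le_one_le[of x t] by auto
    then have "((\<lambda>t. binom_tail \<alpha> (Suc n) (t * x)) has_real_derivative
       (real (Suc n) * binom_coeff \<alpha> (Suc n) * (t * x) ^ (Suc n - 1) * (1 - t * x) powr \<alpha>) * x) (at t)"
      by (intro DERIV_chain2[OF binom_tail_deriv]) (auto intro!: derivative_eq_intros)
    moreover have "(real (Suc n) * binom_coeff \<alpha> (Suc n) * (t * x) ^ (Suc n - 1) * (1 - t * x) powr \<alpha>) * x
       = C * x ^ Suc n * (t ^ n * (1 - t * x) powr \<alpha>)"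
      by (simp add: C_def power_mult_distrib)
    ultimately show "((\<lambda>t. binom_tail \<alpha> (Suc n) (t * x)) has_vector_derivative
        C * x ^ Suc n * (t ^ n * (1 - t * x) powr \<alpha>)) (at t within {0..1})"
      by (metis has_real_derivative_iff_has_vector_derivative has_vector_derivative_at_within)
  qed simp
  from integral_unique[OF this]
  show ?thesis
    by (simp add: binom_tail_at_0 radial_def C_def del: of_nat_Suc power_Suc)
qed

lemma radial_nonneg: "0 \<le> x \<Longrightarrow> x < 1 \<Longrightarrow> 0 \<le> radial \<alpha> n x"
  unfolding radial_def
  by (intro integral_nonneg integrable_continuous_interval continuous_on_mult
      continuous_on_power continuous_on_id radial_integrand_continuous) auto

text \<open>The sum of the two possible maxima covers both signs of \<open>\<alpha>\<close>.\<close>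

lemma radial_integrand_le:
  fixes x t :: real
  assumes "0 \<le> x" "x < 1" "t \<in> {0..1}"
  shows "(1 - t * x) powr \<alpha> \<le> 1 + (1 - x) powr \<alpha>"
proof -
  have tx: "t * x \<le> x" using assms mult_left_le_one_le[of x t] by simp
  show ?thesis
  proof (cases "\<alpha> \<ge> 0")
    case True
    then have "(1 - t * x) powr \<alpha> \<le> 1 powr \<alpha>"
      using assms tx by (intro powr_mono2) auto
    then show ?thesis by (simp add: add_increasing2)
  next
    case False
    then have "(1 - t * x) powr \<alpha> \<le> (1 - x) powr \<alpha>"
      using assms tx by (intro powr_mono2') auto
    then show ?thesis by simp
  qed
qed

lemma radial_le:
  assumes "0 \<le> x" "x < 1"
  shows "radial \<alpha> n x \<le> 1 + (1 - x) powr \<alpha>"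
proof -
  have "radial \<alpha> n x \<le> integral {0..1} (\<lambda>t::real. 1 + (1 - x) powr \<alpha>)"
    unfolding radial_def
  proof (rule integral_le)
    fix t :: real assume t: "t \<in> {0..1}"
    have "t ^ n * (1 - t * x) powr \<alpha> \<le> 1 * (1 + (1 - x) powr \<alpha>)"
      using t by (intro mult_mono radial_integrand_le assms power_le_one) auto
    then show "t ^ n * (1 - t * x) powr \<alpha> \<le> 1 + (1 - x) powr \<alpha>" by simp
  next
    show "(\<lambda>t. t ^ n * (1 - t * x) powr \<alpha>) integrable_on {0..1}"
      by (intro integrable_continuous_interval continuous_on_mult
          continuous_on_power continuous_on_id radial_integrand_continuous assms)
  qed auto
  then show ?thesis by simp
qed

lemma binom_tail_nonneg:
  assumes "\<alpha> > -1" "0 \<le> x" "x < 1"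
  shows "0 \<le> binom_tail \<alpha> (Suc n) x"
  unfolding radial_tail[OF assms(2,3), symmetric]
  using assms binom_coeff_pos[of \<alpha> "Suc n"] radial_nonneg[of x \<alpha> n]
  by (intro mult_nonneg_nonneg) auto

section \<open>Wirtinger derivatives and the equation\<close>

text \<open>Continuous partial derivatives on a rectangle around \<open>z\<close> give the total derivative in the real
  coordinates, which is carried over to \<open>complex\<close> by the chain rule.\<close>

lemma C1_on_has_derivative:
  assumes C1: "C1_on S f" and S: "open S" and z: "z \<in> S"
  shows "(f has_derivative (\<lambda>v. of_real (Re v) * partial_x f z + of_real (Im v) * partial_y f z)) (at z)"
proof -
  obtain e where e: "e > 0" "ball z e \<subseteq> S" using S z open_contains_ball by blast
  define X where "X = ball (Re z) (e / 2)"
  define Y where "Y = ball (Im z) (e / 2)"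
  have XY: "Complex x y \<in> S" if "x \<in> X" "y \<in> Y" for x y
  proof -
    have "cmod (Complex x y - z) \<le> \<bar>x - Re z\<bar> + \<bar>y - Im z\<bar>"
      using cmod_le[of "Complex x y - z"] by simp
    also have "\<dots> < e" using that by (auto simp: X_def Y_def dist_real_def abs_minus_commute)
    finally show ?thesis using e by (auto simp: dist_norm norm_minus_commute)
  qed
  have zXY: "Re z \<in> X" "Im z \<in> Y" using e by (auto simp: X_def Y_def)
  have dx: "((\<lambda>x'. f (Complex x' y)) has_vector_derivative partial_x f (Complex x y)) (at x)"
    if "x \<in> X" "y \<in> Y" for x y
  proof -
    have "((\<lambda>t. f (Complex x y + of_real t)) has_vector_derivative partial_x f (Complex x y)) (at (x - x))"
      using C1 XY[OF that] by (simp add: C1_on_def partial_x_def vector_derivative_works)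
    moreover have "((\<lambda>x'. x' - x) has_vector_derivative 1) (at x)"
      by (auto intro!: derivative_eq_intros)
    ultimately have "((\<lambda>t. f (Complex x y + of_real t)) \<circ> (\<lambda>x'. x' - x) has_vector_derivative
        1 *\<^sub>R partial_x f (Complex x y)) (at x)"
      by (intro vector_diff_chain_at)
    moreover have "Complex x y + of_real (x' - x) = Complex x' y" for x'
      by (simp add: complex_eq_iff)
    ultimately show ?thesis by (simp add: o_def)
  qed
  have dy: "((\<lambda>y'. f (Complex x y')) has_vector_derivative partial_y f (Complex x y)) (at y)"
    if "x \<in> X" "y \<in> Y" for x y
  proof -
    have "((\<lambda>t. f (Complex x y + \<i> * of_real t)) has_vector_derivative partial_y f (Complex x y)) (at (y - y))"
      using C1 XY[OF that] by (simp add: C1_on_def partial_y_def vector_derivative_works)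
    moreover have "((\<lambda>x'. x' - y) has_vector_derivative 1) (at y)"
      by (auto intro!: derivative_eq_intros)
    ultimately have "((\<lambda>t. f (Complex x y + \<i> * of_real t)) \<circ> (\<lambda>x'. x' - y) has_vector_derivative
        1 *\<^sub>R partial_y f (Complex x y)) (at y)"
      by (intro vector_diff_chain_at)
    moreover have "Complex x y + \<i> * of_real (y' - y) = Complex x y'" for y'
      by (simp add: complex_eq_iff)
    ultimately show ?thesis by (simp add: o_def)
  qed
  have "continuous_on (X \<times> Y) (\<lambda>(x, y). Complex x y)"
    unfolding Complex_eq case_prod_beta by (intro continuous_intros)
  then have cont: "continuous_on (X \<times> Y) (\<lambda>(x, y). blinfun_scaleR_left (partial_y f (Complex x y)))"
    using C1 XY
    by (auto simp: C1_on_def case_prod_beta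
        intro!: bounded_linear.continuous_on[OF bounded_linear_blinfun_scaleR_left]
          continuous_on_compose2[where t = S and g = "partial_y f"])
  have "((\<lambda>(x, y). f (Complex x y)) has_derivative
      (\<lambda>(tx, ty). tx *\<^sub>R partial_x f z + blinfun_scaleR_left (partial_y f (Complex (Re z) (Im z))) ty))
      (at (Re z, Im z) within X \<times> Y)"
  proof (rule has_derivative_partialsI[where f = "\<lambda>x y. f (Complex x y)"])
    show "((\<lambda>x. f (Complex x (Im z))) has_derivative (\<lambda>tx. tx *\<^sub>R partial_x f z)) (at (Re z) within X)"
      using dx[OF zXY] by (simp add: has_vector_derivative_def has_derivative_at_withinI)
    show "((\<lambda>y. f (Complex x y)) has_derivative
        blinfun_apply (blinfun_scaleR_left (partial_y f (Complex x y)))) (at y within Y)"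
      if "x \<in> X" "y \<in> Y" for x y
      using dy[OF that] by (simp add: has_vector_derivative_def has_derivative_at_withinI)
    show "continuous (at (Re z, Im z) within X \<times> Y)
        (\<lambda>(x, y). blinfun_scaleR_left (partial_y f (Complex x y)))"
      using cont zXY by (auto simp: continuous_on_eq_continuous_within)
  qed (use zXY in \<open>auto simp: Y_def\<close>)
  then have "((\<lambda>(x, y). f (Complex x y)) has_derivative
      (\<lambda>(tx, ty). tx *\<^sub>R partial_x f z + ty *\<^sub>R partial_y f z)) (at (Re z, Im z))"
    using zXY by (subst (asm) at_within_open) (auto simp: X_def Y_def open_Times)
  moreover have "((\<lambda>w. (Re w, Im w)) has_derivative (\<lambda>w. (Re w, Im w))) (at z)"
    by (intro derivative_intros)
  ultimately have "((\<lambda>w. (\<lambda>(x, y). f (Complex x y)) (Re w, Im w)) has_derivative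
      (\<lambda>v. (\<lambda>(tx, ty). tx *\<^sub>R partial_x f z + ty *\<^sub>R partial_y f z) (Re v, Im v))) (at z)"
    by (rule has_derivative_compose[rotated])
  then show ?thesis by (simp add: scaleR_conv_of_real)
qed

lemma partials_of_has_derivative:
  assumes D: "(g has_derivative D) (at z)"
  shows "partial_x g z = D 1" "partial_y g z = D \<i>"
proof -
  interpret D: bounded_linear D using D by (rule has_derivative_bounded_linear)
  have "((\<lambda>t::real. g (z + c * of_real t)) has_vector_derivative D c) (at 0)" for c
  proof -
    have "((\<lambda>t::real. z + c * of_real t) has_derivative (\<lambda>t. c * of_real t)) (at 0)"
      by (auto intro!: derivative_eq_intros)
    from has_derivative_compose[OF this, of g D] D
    have "((\<lambda>t::real. g (z + c * of_real t)) has_derivative (\<lambda>t. D (c * of_real t))) (at 0)"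
      by simp
    moreover have "D (c * of_real t) = t *\<^sub>R D c" for t
      by (metis D.scaleR mult.commute scaleR_conv_of_real)
    ultimately show ?thesis by (simp add: has_vector_derivative_def)
  qed
  from this[of 1] this[of \<i>] show "partial_x g z = D 1" "partial_y g z = D \<i>"
    by (auto simp: partial_x_def partial_y_def vector_derivative_at)
qed

text \<open>The vanishing of the Wirtinger derivative is the Cauchy--Riemann equation for the conjugate.\<close>

lemma wirtinger_zero_imp_antiholomorphic:
  assumes D: "g differentiable (at z)" and 0: "wirtinger g z = 0"
  shows "(\<lambda>w. cnj (g w)) field_differentiable (at z)"
proof -
  obtain D where D: "(g has_derivative D) (at z)" using D by (auto simp: differentiable_def)
  interpret D: bounded_linear D using D by (rule has_derivative_bounded_linear)
  have Di: "D \<i> = - \<i> * D 1"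
  proof -
    have "D 1 = \<i> * D \<i>"
      using 0 by (simp add: wirtinger_def partials_of_has_derivative[OF D])
    then show ?thesis by simp
  qed
  have "D v = cnj v * D 1" for v
  proof -
    have "D v = D (Re v *\<^sub>R 1 + Im v *\<^sub>R \<i>)"
      by (rule arg_cong[of _ _ D]) (simp add: complex_eq_iff)
    also have "\<dots> = Re v *\<^sub>R D 1 + Im v *\<^sub>R D \<i>"
      by (simp only: D.add D.scaleR)
    also have "\<dots> = (of_real (Re v) - \<i> * of_real (Im v)) * D 1"
      by (simp add: Di scaleR_conv_of_real algebra_simps)
    also have "of_real (Re v) - \<i> * of_real (Im v) = cnj v"
      by (simp add: complex_eq_iff)
    finally show ?thesis .
  qed
  then have "(\<lambda>v. cnj (D v)) = (\<lambda>v. cnj (D 1) * v)"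
    by (metis (no_types) complex_cnj_cnj complex_cnj_mult mult.commute)
  with bounded_linear.has_derivative[OF bounded_linear_cnj D]
  have "((\<lambda>w. cnj (g w)) has_derivative (\<lambda>v. cnj (D 1) * v)) (at z)"
    by (simp only:)
  then show ?thesis
    by (auto simp: field_differentiable_def has_field_derivative_def)
qed

lemma one_minus_cmod_sq_pos: "z \<in> ball 0 1 \<Longrightarrow> 0 < 1 - (cmod z)\<^sup>2"
  by (simp add: abs_square_less_1)

text \<open>First integration of the equation: the function \<open>h\<close> is the conjugate of the weighted
  anti-holomorphic derivative, to which the preceding lemma applies.\<close>

lemma alpha_harmonic_wirtinger_bar:
  assumes "alpha_harmonic \<alpha> f"
  obtains h where "h holomorphic_on ball 0 1"
    "\<And>z. z \<in> ball 0 1 \<Longrightarrow> wirtinger_bar f z = of_real ((1 - (cmod z)\<^sup>2) powr \<alpha>) * cnj (h z)"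
proof
  let ?g = "\<lambda>w. of_real ((1 - (cmod w)\<^sup>2) powr (-\<alpha>)) * wirtinger_bar f w"
  have C2: "C2_on (ball 0 1) f" and w: "\<And>z. z \<in> ball 0 1 \<Longrightarrow> wirtinger ?g z = 0"
    using assms by (auto simp: alpha_harmonic_def)
  have "?g differentiable (at z)" if z: "z \<in> ball 0 1" for z
  proof -
    have "partial_x f differentiable (at z)" "partial_y f differentiable (at z)"
      using C2 C1_on_has_derivative[OF _ open_ball z] by (auto simp: C2_on_def differentiable_def)
    then have "wirtinger_bar f differentiable (at z)"
      unfolding wirtinger_bar_def[abs_def] by (intro derivative_intros) auto
    moreover have "((\<lambda>w. (1 - ((Re w)\<^sup>2 + (Im w)\<^sup>2)) powr (-\<alpha>)) has_derivative
       (\<lambda>v. (1 - ((Re z)\<^sup>2 + (Im z)\<^sup>2)) powr (-\<alpha>) * ((- (2 * Re v * Re z + 2 * Im v * Im z)) * (-\<alpha>) / (1 - ((Re z)\<^sup>2 + (Im z)\<^sup>2))))) (at z)"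
      using one_minus_cmod_sq_pos[OF z] unfolding cmod_power2
      by (auto intro!: derivative_eq_intros simp: algebra_simps)
    then have "(\<lambda>w. complex_of_real ((1 - (cmod w)\<^sup>2) powr (-\<alpha>))) differentiable (at z)"
      unfolding cmod_power2
      using bounded_linear.has_derivative[OF bounded_linear_of_real] by (auto simp: differentiable_def)
    ultimately show ?thesis by (intro differentiable_mult)
  qed
  then show "(\<lambda>z. cnj (?g z)) holomorphic_on ball 0 1"
    unfolding holomorphic_on_def
    using wirtinger_zero_imp_antiholomorphic[of ?g] w by (blast intro: field_differentiable_at_within)
  fix z :: complex assume "z \<in> ball 0 1"
  from one_minus_cmod_sq_pos[OF this]
  have "(1 - (cmod z)\<^sup>2) powr \<alpha> * (1 - (cmod z)\<^sup>2) powr (- \<alpha>) = 1"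
    by (simp flip: powr_add)
  then have "complex_of_real ((1 - (cmod z)\<^sup>2) powr \<alpha>) * of_real ((1 - (cmod z)\<^sup>2) powr (- \<alpha>)) = 1"
    by (metis of_real_1 of_real_mult)
  then show "wirtinger_bar f z = of_real ((1 - (cmod z)\<^sup>2) powr \<alpha>) * cnj (cnj (?g z))"
    by (simp add: mult.assoc[symmetric])
qed

section \<open>A particular solution\<close>

text \<open>The weight is evaluated at \<open>t |z|\<^sup>2\<close> and not at \<open>|t z|\<^sup>2\<close>: with this choice the integrand of the
  anti-holomorphic derivative below is an exact derivative in \<open>t\<close>.\<close>

definition particular_solution :: "real \<Rightarrow> (complex \<Rightarrow> complex) \<Rightarrow> complex \<Rightarrow> complex" where
  "particular_solution \<alpha> h z =
     integral {0..1} (\<lambda>t. cnj (z * h (of_real t * z)) * of_real ((1 - t * (cmod z)\<^sup>2) powr \<alpha>))"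

lemma segment_in_disc:
  "z \<in> ball 0 1 \<Longrightarrow> t \<in> {0..1} \<Longrightarrow> complex_of_real t * z \<in> ball 0 1"
  using mult_left_le_one_le[of "cmod z" t] by (auto simp: norm_mult)

lemma segment_weight_pos:
  assumes "z \<in> ball 0 1" "t \<in> {0..1}"
  shows "0 < 1 - t * (cmod z)\<^sup>2"
proof -
  have "t * (cmod z)\<^sup>2 \<le> (cmod z)\<^sup>2" using assms(2) by (simp add: mult_left_le_one_le)
  with one_minus_cmod_sq_pos[OF assms(1)] show ?thesis by linarith
qed

text \<open>Differentiation under the integral sign. The coefficient \<open>A\<close> of \<open>cnj v\<close> in the derivative of the
  integrand is the \<open>t\<close>-derivative of \<open>t cnj (h (t z)) (1 - t |z|\<^sup>2)\<^sup>\<alpha>\<close>, so its integral is the value of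
  this function at \<open>t = 1\<close>. The term with \<open>B\<close> is complex linear in \<open>v\<close> and
  does not contribute to the anti-holomorphic derivative.\<close>

lemma particular_solution_has_derivative:
  assumes h: "h holomorphic_on ball 0 1" and z: "z \<in> ball 0 1"
  obtains B where "(particular_solution \<alpha> h has_derivative
    (\<lambda>v. of_real ((1 - (cmod z)\<^sup>2) powr \<alpha>) * cnj (h z) * cnj v + B * v)) (at z)"
proof -
  define D where "D = ball (0::complex) 1"
  define W where "W = (\<lambda>z t. complex_of_real ((1 - t * (cmod z)\<^sup>2) powr \<alpha>))"
  define W' where "W' = (\<lambda>z t. complex_of_real (- (t * \<alpha> * (1 - t * (cmod z)\<^sup>2) powr (\<alpha> - 1))))"
  define k where "k = (\<lambda>z t. cnj (z * h (of_real t * z)) * W z t)"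
  define A where "A = (\<lambda>z t. cnj (h (of_real t * z) + z * (of_real t * deriv h (of_real t * z))) * W z t
      + cnj (z * h (of_real t * z)) * W' z t * z)"
  define B where "B = (\<lambda>z t. cnj (z * h (of_real t * z)) * W' z t * cnj z)"
  define fx where "fx = (\<lambda>z t. (blinfun_mult_right (A z t) o\<^sub>L Blinfun cnj) + blinfun_mult_right (B z t))"
  have fx: "blinfun_apply (fx z t) v = A z t * cnj v + B z t * v" for z t v
    by (simp add: fx_def blinfun.add_left bounded_linear_Blinfun_apply bounded_linear_cnj)
  have dh: "(h has_field_derivative deriv h w) (at w)" if "w \<in> D" for w
    using h that by (auto simp: D_def intro: holomorphic_derivI)
  have dW: "((\<lambda>z. W z t) has_derivative (\<lambda>v. W' z t * (cnj z * v + z * cnj v))) (at z)"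
    if "z \<in> D" "t \<in> {0..1}" for z t
  proof -
    have "((\<lambda>z. (1 - t * ((Re z)\<^sup>2 + (Im z)\<^sup>2)) powr \<alpha>) has_derivative
        (\<lambda>v. - (t * \<alpha> * (1 - t * (cmod z)\<^sup>2) powr (\<alpha> - 1)) * (2 * (Re z * Re v + Im z * Im v)))) (at z)"
      using segment_weight_pos[OF that[unfolded D_def]] unfolding cmod_power2
      by (auto intro!: derivative_eq_intros simp: powr_diff algebra_simps add_divide_distrib diff_divide_distrib)
    from bounded_linear.has_derivative[OF bounded_linear_of_real this]
    have "((\<lambda>z. W z t) has_derivative
        (\<lambda>v. W' z t * of_real (2 * (Re z * Re v + Im z * Im v)))) (at z)"
      by (simp add: W_def W'_def cmod_power2)
    moreover have "complex_of_real (2 * (Re z * Re v + Im z * Im v)) = cnj z * v + z * cnj v" for v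
      by (simp add: complex_eq_iff)
    ultimately show ?thesis by simp
  qed
  have dk: "((\<lambda>z. k z t) has_derivative blinfun_apply (fx z t)) (at z within D)"
    if "z \<in> D" "t \<in> {0..1}" for z t
  proof -
    have tz: "of_real t * z \<in> D" using segment_in_disc that by (simp add: D_def)
    have "((\<lambda>z. h (of_real t * z)) has_field_derivative deriv h (of_real t * z) * of_real t) (at z)"
      by (rule DERIV_chain2[of h _ "\<lambda>z. of_real t * z", OF dh[OF tz]]) (auto intro!: derivative_eq_intros)
    then have "((\<lambda>z. z * h (of_real t * z)) has_field_derivative
        h (of_real t * z) + z * (of_real t * deriv h (of_real t * z))) (at z)"
      by (auto intro!: derivative_eq_intros)
    then have "((\<lambda>z. cnj (z * h (of_real t * z))) has_derivative
        (\<lambda>v. cnj ((h (of_real t * z) + z * (of_real t * deriv h (of_real t * z))) * v))) (at z)"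
      unfolding has_field_derivative_def by (rule bounded_linear.has_derivative[OF bounded_linear_cnj])
    from has_derivative_mult[OF this dW[OF that]]
    have "((\<lambda>z. k z t) has_derivative blinfun_apply (fx z t)) (at z)"
      unfolding k_def
      by (rule has_derivative_eq_rhs) (auto simp: fun_eq_iff fx A_def B_def algebra_simps)
    then show ?thesis by (rule has_derivative_at_withinI)
  qed
  have conth: "continuous_on (D \<times> {0..1}) (\<lambda>p. g (of_real (snd p) * fst p))"
    if "continuous_on D g" for g :: "complex \<Rightarrow> complex"
    by (rule continuous_on_compose2[OF that])
       (auto intro!: continuous_intros simp: D_def simp del: mem_ball segment_in_disc intro: segment_in_disc)
  have holh: "continuous_on D h" "continuous_on D (deriv h)"
    using h by (auto simp: D_def intro!: holomorphic_on_imp_continuous_on holomorphic_deriv)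
  have nz: "1 - snd p * (cmod (fst p))\<^sup>2 \<noteq> 0" if "p \<in> D \<times> {0..1}" for p
    using segment_weight_pos[of "fst p" "snd p"] that by (auto simp: D_def)
  have contW: "continuous_on (D \<times> {0..1}) (\<lambda>p. W (fst p) (snd p))"
       "continuous_on (D \<times> {0..1}) (\<lambda>p. W' (fst p) (snd p))"
    unfolding W_def W'_def using nz by (auto intro!: continuous_intros)
  have contA: "continuous_on (D \<times> {0..1}) (\<lambda>p. A (fst p) (snd p))"
    and contB: "continuous_on (D \<times> {0..1}) (\<lambda>p. B (fst p) (snd p))"
    and contk: "continuous_on (D \<times> {0..1}) (\<lambda>p. k (fst p) (snd p))"
    unfolding A_def B_def k_def
    by (intro continuous_intros contW conth holh)+
  have contPair: "continuous_on {0..1} (\<lambda>t. (z, t))" for z :: complex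
    by (intro continuous_on_Pair continuous_on_const continuous_on_id)
  have slice: "continuous_on {0..1} (\<lambda>t. g z t)" if "continuous_on (D \<times> {0..1}) (\<lambda>p. g (fst p) (snd p))" "z \<in> D"
    for g :: "complex \<Rightarrow> real \<Rightarrow> complex" and z
    using continuous_on_compose2[OF that(1), of "{0..1}" "\<lambda>t. (z, t)"] contPair[of z] that(2)
    by auto
  have contfx: "continuous_on (D \<times> cbox 0 1) (\<lambda>(z, t). fx z t)"
    unfolding fx_def case_prod_beta cbox_interval
    by (intro continuous_intros bounded_linear.continuous_on[OF bounded_linear_blinfun_mult_right] contA contB)
  have openD: "open D" by (simp add: D_def)
  have zD: "z \<in> D" using z by (simp add: D_def)
  have "((\<lambda>z. integral (cbox 0 1) (k z)) has_derivative integral (cbox 0 1) (fx z)) (at z within D)"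
    by (rule leibniz_rule[OF _ _ contfx zD])
       (use dk slice[OF contk] in \<open>auto simp: D_def intro!: integrable_continuous_interval\<close>)
  then have "(particular_solution \<alpha> h has_derivative integral {0..1} (fx z)) (at z)"
    unfolding at_within_open[OF zD openD] k_def W_def cbox_interval particular_solution_def[abs_def] .
  moreover have "blinfun_apply (integral {0..1} (fx z)) v =
      of_real ((1 - (cmod z)\<^sup>2) powr \<alpha>) * cnj (h z) * cnj v + integral {0..1} (B z) * v" for v
  proof -
    have "continuous_on {0..1} (fx z)"
      using continuous_on_compose2[OF contfx, of "{0..1}" "\<lambda>t. (z, t)"] contPair[of z] zD
      by auto
    then have "blinfun_apply (integral {0..1} (fx z)) v = integral {0..1} (\<lambda>t. fx z t v)"
      by (intro blinfun_apply_integral integrable_continuous_interval)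
    also have "\<dots> = integral {0..1} (\<lambda>t. A z t * cnj v) + integral {0..1} (\<lambda>t. B z t * v)"
      unfolding fx using slice[OF contA zD] slice[OF contB zD]
      by (intro integral_add integrable_continuous_interval continuous_intros) auto
    also have "\<dots> = integral {0..1} (A z) * cnj v + integral {0..1} (B z) * v"
      by (simp add: integral_mult_left)
    also have "integral {0..1} (A z) = of_real ((1 - (cmod z)\<^sup>2) powr \<alpha>) * cnj (h z)"
    proof -
      have "(A z has_integral (of_real 1 * cnj (h (of_real 1 * z)) * W z 1 - of_real 0 * cnj (h (of_real 0 * z)) * W z 0)) {0..1}"
      proof (rule fundamental_theorem_of_calculus)
        fix t :: real assume t: "t \<in> {0..1}"
        have tz: "of_real t * z \<in> D" using segment_in_disc zD t by (simp add: D_def)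
        have "((\<lambda>t. h (of_real t * z)) has_vector_derivative z * deriv h (of_real t * z)) (at t)"
        proof -
          have "((\<lambda>t. of_real t * z) has_vector_derivative z) (at t)"
            by (auto intro!: derivative_eq_intros simp: has_vector_derivative_def scaleR_conv_of_real)
          from field_vector_diff_chain_at[OF this, of h "deriv h (of_real t * z)"] dh[OF tz]
          show ?thesis by (simp add: o_def)
        qed
        then have 1: "((\<lambda>t. cnj (h (of_real t * z))) has_vector_derivative cnj (z * deriv h (of_real t * z))) (at t)"
          by (rule bounded_linear.has_vector_derivative[OF bounded_linear_cnj])
        have "((\<lambda>t. (1 - t * (cmod z)\<^sup>2) powr \<alpha>) has_real_derivative
             - ((cmod z)\<^sup>2 * \<alpha> * (1 - t * (cmod z)\<^sup>2) powr (\<alpha> - 1))) (at t)"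
          using segment_weight_pos[OF z t]
          by (auto intro!: derivative_eq_intros simp: powr_diff algebra_simps)
        then have "((\<lambda>t. W z t) has_vector_derivative of_real (- ((cmod z)\<^sup>2 * \<alpha> * (1 - t * (cmod z)\<^sup>2) powr (\<alpha> - 1)))) (at t)"
          unfolding W_def has_real_derivative_iff_has_vector_derivative
          by (rule bounded_linear.has_vector_derivative[OF bounded_linear_of_real])
        note 2 = this[unfolded of_real_minus of_real_mult complex_norm_square]
        have 3: "((\<lambda>t. complex_of_real t) has_vector_derivative 1) (at t)"
          by (auto intro!: derivative_eq_intros simp: has_vector_derivative_def scaleR_conv_of_real)
        have "((\<lambda>t. of_real t * cnj (h (of_real t * z)) * W z t) has_vector_derivative A z t) (at t)"
          by (rule has_vector_derivative_eq_rhs[OF has_vector_derivative_mult[OF has_vector_derivative_mult[OF 3 1] 2]])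
             (simp add: A_def W'_def algebra_simps)
        then show "((\<lambda>t. of_real t * cnj (h (of_real t * z)) * W z t) has_vector_derivative A z t) (at t within {0..1})"
          by (rule has_vector_derivative_at_within)
      qed simp
      from integral_unique[OF this] show ?thesis by (simp add: W_def mult.commute)
    qed
    finally show ?thesis .
  qed
  ultimately have "(particular_solution \<alpha> h has_derivative (\<lambda>v. of_real ((1 - (cmod z)\<^sup>2) powr \<alpha>) * cnj (h z) * cnj v
      + integral {0..1} (B z) * v)) (at z)"
    by (metis (no_types, lifting) ext)
  then show ?thesis by (rule that)
qed

text \<open>Both functions have the same anti-holomorphic derivative, so the derivative of the difference is
  complex linear.\<close>

lemma alpha_harmonic_minus_particular_solution:
  assumes "alpha_harmonic \<alpha> f"
  obtains h where "h holomorphic_on ball 0 1" "(\<lambda>z. f z - particular_solution \<alpha> h z) holomorphic_on ball 0 1"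
proof -
  obtain h where h: "h holomorphic_on ball 0 1"
    and bar: "\<And>z. z \<in> ball 0 1 \<Longrightarrow> wirtinger_bar f z = of_real ((1 - (cmod z)\<^sup>2) powr \<alpha>) * cnj (h z)"
    by (rule alpha_harmonic_wirtinger_bar[OF assms]) blast
  have "(\<lambda>z. f z - particular_solution \<alpha> h z) field_differentiable (at z within ball 0 1)" if z: "z \<in> ball 0 1" for z
  proof -
    obtain B where B: "(particular_solution \<alpha> h has_derivative (\<lambda>v. wirtinger_bar f z * cnj v + B * v)) (at z)"
      using particular_solution_has_derivative[OF h z, of \<alpha>] unfolding bar[OF z] by metis
    have "(f has_derivative (\<lambda>v. of_real (Re v) * partial_x f z + of_real (Im v) * partial_y f z)) (at z)"
      using assms z by (intro C1_on_has_derivative[of "ball 0 1"]) (auto simp: alpha_harmonic_def C2_on_def)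
    moreover have "of_real (Re v) * partial_x f z + of_real (Im v) * partial_y f z
        = wirtinger f z * v + wirtinger_bar f z * cnj v" for v
      by (subst (3 6) complex_eq) (simp add: wirtinger_def wirtinger_bar_def field_simps)
    ultimately have "(f has_derivative (\<lambda>v. wirtinger f z * v + wirtinger_bar f z * cnj v)) (at z)"
      by simp
    from has_derivative_diff[OF this B]
    have "((\<lambda>z. f z - particular_solution \<alpha> h z) has_field_derivative (wirtinger f z - B)) (at z)"
      unfolding has_field_derivative_def
      by (rule has_derivative_eq_rhs) (simp add: fun_eq_iff algebra_simps)
    then show ?thesis
      using field_differentiable_at_within field_differentiable_def by blast
  qed
  with h show ?thesis by (intro that[of h]) (auto simp: holomorphic_on_def)
qed

section \<open>Expansion of alpha-harmonic functions\<close>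

text \<open>The conditions record what the convergence argument uses, in a form that is stable under rotations:
  the coefficients have radius of convergence at least \<open>1\<close>, and \<open>f\<close> is continuous.\<close>

definition has_expansion ::
  "real \<Rightarrow> (complex \<Rightarrow> complex) \<Rightarrow> (complex \<Rightarrow> complex) \<Rightarrow> (nat \<Rightarrow> complex) \<Rightarrow> bool" where
  "has_expansion \<alpha> f H \<beta> \<longleftrightarrow> continuous_on (ball 0 1) f \<and> H holomorphic_on ball 0 1 \<and>
     (\<forall>s. 0 \<le> s \<longrightarrow> s < 1 \<longrightarrow> summable (\<lambda>n. norm (\<beta> n) * s ^ n)) \<and>
     (\<forall>z\<in>ball 0 1. (\<lambda>n. \<beta> n * cnj z ^ Suc n * of_real (radial \<alpha> n ((cmod z)\<^sup>2))) sums (f z - H z))"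

text \<open>Rotations reduce the final estimate to points of the positive real axis.\<close>

lemma has_expansion_rotate:
  assumes "has_expansion \<alpha> f H \<beta>" and c: "cmod c = 1"
  shows "has_expansion \<alpha> (\<lambda>z. f (c * z)) (\<lambda>z. H (c * z)) (\<lambda>n. \<beta> n * cnj c ^ Suc n)"
proof -
  have cz: "c * z \<in> ball 0 1" if "z \<in> ball 0 1" for z
    using that c by (simp add: norm_mult)
  have "(\<lambda>z. H (c * z)) holomorphic_on ball 0 1"
    using assms(1) cz
    by (intro holomorphic_on_compose_gen[of "\<lambda>z. c * z" _ H "ball 0 1", unfolded o_def] holomorphic_intros)
       (auto simp: has_expansion_def)
  moreover have "continuous_on (ball 0 1) (\<lambda>z. f (c * z))"
    using assms(1) cz
    by (intro continuous_on_compose2[of "ball 0 1" f _ "\<lambda>z. c * z"] continuous_intros)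
       (auto simp: has_expansion_def)
  moreover have "norm (\<beta> n * cnj c ^ Suc n) = norm (\<beta> n)" for n
    using c by (simp only: norm_mult norm_power complex_mod_cnj power_one mult_1_right)
  moreover have "(\<lambda>n. \<beta> n * cnj c ^ Suc n * cnj z ^ Suc n * of_real (radial \<alpha> n ((cmod z)\<^sup>2)))
      sums (f (c * z) - H (c * z))" if "z \<in> ball 0 1" for z
  proof -
    have "(\<lambda>n. \<beta> n * cnj (c * z) ^ Suc n * of_real (radial \<alpha> n ((cmod (c * z))\<^sup>2)))
        sums (f (c * z) - H (c * z))"
      using assms(1) cz[OF that] unfolding has_expansion_def by blast
    then show ?thesis
      by (simp add: c norm_mult power_mult_distrib mult_ac)
  qed
  ultimately show ?thesis
    using assms(1) unfolding has_expansion_def by simp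
qed

lemma taylor_coeffs_summable:
  assumes h: "h holomorphic_on ball 0 1" and s: "0 \<le> s" "s < (1::real)"
  shows "summable (\<lambda>n. norm ((deriv ^^ n) h 0 / fact n) * s ^ n)"
proof -
  define w where "w = (1 + s) / 2"
  have w: "s < w" "w < 1" using s by (auto simp: w_def)
  have "(\<lambda>n. (deriv ^^ n) h 0 / fact n * (of_real w - 0) ^ n) sums h (of_real w)"
    using w s by (intro holomorphic_power_series[OF h]) auto
  then have "summable (\<lambda>n. (deriv ^^ n) h 0 / fact n * of_real w ^ n)"
    by (simp add: sums_iff)
  from powser_insidea[OF this, of "of_real s"] w s show ?thesis
    by (simp add: norm_mult norm_power norm_divide)
qed

text \<open>The Taylor series of \<open>h\<close> converges uniformly on the segment from \<open>0\<close> to \<open>z\<close> and may be integrated term by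
  term.\<close>

lemma particular_solution_sums:
  assumes h: "h holomorphic_on ball 0 1" and z: "z \<in> ball 0 1"
  shows "(\<lambda>n. cnj ((deriv ^^ n) h 0 / fact n) * cnj z ^ Suc n * of_real (radial \<alpha> n ((cmod z)\<^sup>2)))
           sums particular_solution \<alpha> h z"
proof -
  define b where "b = (\<lambda>n. (deriv ^^ n) h 0 / fact n)"
  define x where "x = (cmod z)\<^sup>2"
  have x: "0 \<le> x" "x < 1" using one_minus_cmod_sq_pos[OF z] by (auto simp: x_def)
  define u where "u = (\<lambda>n (t::real). (cnj (b n) * cnj z ^ Suc n) * of_real (t ^ n * (1 - t * x) powr \<alpha>))"
  have cont: "continuous_on {0..1} (\<lambda>t. t ^ n * (1 - t * x) powr \<alpha>)" for n
    by (intro continuous_on_mult continuous_on_power continuous_on_id radial_integrand_continuous x)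
  have "(\<lambda>n. integral {0..1} (u n)) sums integral {0..1} (\<lambda>t. \<Sum>n. u n t)"
  proof (rule sums_integral_Weierstrass)
    show "continuous_on {0..1} (u n)" for n
      unfolding u_def by (intro continuous_intros cont)
    have "summable (\<lambda>n. norm (b n) * cmod z ^ n)"
      unfolding b_def using z by (intro taylor_coeffs_summable[OF h]) auto
    then show "summable (\<lambda>n. norm (b n) * cmod z ^ n * (1 + (1 - x) powr \<alpha>))"
      by (rule summable_mult2)
    fix n and t :: real assume t: "t \<in> {0..1}"
    have "cmod z ^ Suc n \<le> cmod z ^ n"
      using z by (intro power_decreasing) auto
    moreover have "t ^ n * (1 - t * x) powr \<alpha> \<le> 1 * (1 + (1 - x) powr \<alpha>)"
      using t by (intro mult_mono radial_integrand_le x power_le_one) auto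
    ultimately show "norm (u n t) \<le> norm (b n) * cmod z ^ n * (1 + (1 - x) powr \<alpha>)"
      using t unfolding u_def norm_mult norm_power complex_mod_cnj norm_of_real
      by (intro mult_mono mult_nonneg_nonneg) auto
  qed
  moreover have "integral {0..1} (u n) = cnj (b n) * cnj z ^ Suc n * of_real (radial \<alpha> n x)" for n
  proof -
    have "integral {0..1} (\<lambda>t. complex_of_real (t ^ n * (1 - t * x) powr \<alpha>)) = of_real (radial \<alpha> n x)"
      using integral_linear[OF integrable_continuous_interval[OF cont] bounded_linear_of_real[where 'a = complex]]
      by (simp add: o_def radial_def)
    then show ?thesis unfolding u_def by (simp only: integral_mult_right)
  qed
  moreover have "integral {0..1} (\<lambda>t. \<Sum>n. u n t) = particular_solution \<alpha> h z"
    unfolding particular_solution_def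
  proof (rule integral_cong)
    fix t :: real assume "t \<in> {0..1}"
    then have "(\<lambda>n. b n * (of_real t * z - 0) ^ n) sums h (of_real t * z)"
      unfolding b_def by (intro holomorphic_power_series[OF h] segment_in_disc z)
    then have "(\<lambda>n. cnj (z * (b n * (of_real t * z - 0) ^ n)) * of_real ((1 - t * x) powr \<alpha>)) sums
        (cnj (z * h (of_real t * z)) * of_real ((1 - t * x) powr \<alpha>))"
      by (intro sums_mult2 sums_cnj[THEN iffD2] sums_mult)
    moreover have "cnj (z * (b n * (of_real t * z - 0) ^ n)) * of_real ((1 - t * x) powr \<alpha>) = u n t" for n
      by (simp add: u_def power_mult_distrib mult_ac)
    ultimately show "(\<Sum>n. u n t) = cnj (z * h (of_real t * z)) * of_real ((1 - t * (cmod z)\<^sup>2) powr \<alpha>)"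
      by (simp add: sums_iff x_def)
  qed
  ultimately show ?thesis by (simp add: b_def x_def)
qed

lemma alpha_harmonic_has_expansion:
  assumes "alpha_harmonic \<alpha> f"
  obtains H \<beta> where "has_expansion \<alpha> f H \<beta>"
proof -
  obtain h where h: "h holomorphic_on ball 0 1" and H: "(\<lambda>z. f z - particular_solution \<alpha> h z) holomorphic_on ball 0 1"
    by (rule alpha_harmonic_minus_particular_solution[OF assms])
  have "f differentiable (at z)" if "z \<in> ball 0 1" for z
    using assms C1_on_has_derivative[OF _ open_ball that]
    by (auto simp: alpha_harmonic_def C2_on_def differentiable_def)
  then have "continuous_on (ball 0 1) f"
    by (meson continuous_at_imp_continuous_on differentiable_imp_continuous_within)
  then have "has_expansion \<alpha> f (\<lambda>z. f z - particular_solution \<alpha> h z) (\<lambda>n. cnj ((deriv ^^ n) h 0 / fact n))"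
    unfolding has_expansion_def complex_mod_cnj
    using particular_solution_sums[OF h] taylor_coeffs_summable[OF h] H by simp
  then show ?thesis by (rule that)
qed

section \<open>Means over the unit circle and the kernel\<close>

definition circle_mean :: "(complex \<Rightarrow> complex) \<Rightarrow> complex" where
  "circle_mean u = integral {0..2 * pi} (\<lambda>t. u (cis t)) / of_real (2 * pi)"

lemma circle_mean_cong:
  "(\<And>\<zeta>. cmod \<zeta> = 1 \<Longrightarrow> u \<zeta> = v \<zeta>) \<Longrightarrow> circle_mean u = circle_mean v"
  by (simp add: circle_mean_def)

lemma circle_mean_mult: "circle_mean (\<lambda>\<zeta>. c * u \<zeta>) = c * circle_mean u"
  by (simp add: circle_mean_def)

lemma circle_mean_cnj: "circle_mean (\<lambda>\<zeta>. cnj (u \<zeta>)) = cnj (circle_mean u)"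
  by (simp add: circle_mean_def flip: integral_cnj)

lemma continuous_on_cis_comp:
  assumes "continuous_on (sphere 0 1) u"
  shows "continuous_on {0..2 * pi} (\<lambda>t. u (cis t))"
  by (rule continuous_on_compose2[OF assms]) (auto intro!: continuous_intros)

lemma circle_mean_sums:
  fixes u :: "nat \<Rightarrow> complex \<Rightarrow> complex"
  assumes "\<And>n. continuous_on (sphere 0 1) (u n)"
    and "\<And>n \<zeta>. cmod \<zeta> = 1 \<Longrightarrow> norm (u n \<zeta>) \<le> M n" and "summable M"
  shows "(\<lambda>n. circle_mean (u n)) sums circle_mean (\<lambda>\<zeta>. \<Sum>n. u n \<zeta>)"
  unfolding circle_mean_def
  by (intro sums_divide sums_integral_Weierstrass[where M = M])
     (use assms continuous_on_cis_comp in auto)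

text \<open>On the unit circle \<open>1 - a cnj \<zeta> = (\<zeta> - a) / \<zeta>\<close>, so this is the Cauchy integral formula.\<close>

lemma circle_mean_Cauchy:
  assumes u: "u holomorphic_on ball 0 R" and R: "R > 1" and a: "cmod a < 1"
  shows "circle_mean (\<lambda>\<zeta>. u \<zeta> / (1 - a * cnj \<zeta>)) = u a"
proof -
  have "continuous_on (cball 0 1) u" "u holomorphic_on ball 0 1"
    using u R by (auto intro!: holomorphic_on_imp_continuous_on elim!: holomorphic_on_subset)
  from Cauchy_integral_circlepath[OF this, of a] a
  have "((\<lambda>\<zeta>. u \<zeta> / (\<zeta> - a)) has_contour_integral 2 * of_real pi * \<i> * u a) (circlepath 0 1)"
    by simp
  then have "((\<lambda>t. u (cis t) / (cis t - a) * \<i> * cis t) has_integral 2 * of_real pi * \<i> * u a) {0..2 * pi}"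
    unfolding circlepath_def by (subst (asm) has_contour_integral_part_circlepath_iff) simp_all
  from has_integral_mult_right[OF this, of "- \<i>"]
  have I: "((\<lambda>t. u (cis t) / (cis t - a) * cis t) has_integral 2 * of_real pi * u a) {0..2 * pi}"
    by (simp add: algebra_simps)
  have "u (cis t) / (cis t - a) * cis t = u (cis t) / (1 - a * cnj (cis t))" for t
  proof -
    have "cis t - a \<noteq> 0" using a by auto
    moreover have "(1 - a * cnj (cis t)) * cis t = cis t - a"
      by (simp add: algebra_simps cis_cnj cis_mult)
    ultimately show ?thesis by (metis div_by_0 divide_divide_eq_right mult_eq_0_iff times_divide_eq_left nonzero_mult_divide_mult_cancel_right cis_neq_zero)
  qed
  with I show ?thesis
    by (simp add: circle_mean_def integral_unique)
qed

text \<open>The radius \<open>2 / (1 + r)\<close> lies between \<open>1\<close> and \<open>1 / r\<close>, and it is also defined for \<open>r = 0\<close>.\<close>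

lemma poisson_radius:
  assumes "0 \<le> r" "r < (1::real)"
  obtains R where "R > 1" "\<And>\<zeta>. \<zeta> \<in> ball 0 R \<Longrightarrow> cmod (of_real r * \<zeta>) < 1"
proof
  show "2 / (1 + r) > 1" using assms by (simp add: field_simps)
  fix \<zeta> :: complex assume "\<zeta> \<in> ball 0 (2 / (1 + r))"
  then have "cmod \<zeta> * (1 + r) < 2" using assms by (simp add: field_simps)
  moreover have "r * (cmod \<zeta> * (1 + r)) \<le> r * 2"
    using calculation assms by (intro mult_left_mono) auto
  ultimately have "(r * cmod \<zeta>) * (1 + r) < 1 * (1 + r)"
    using assms by (simp add: algebra_simps)
  then have "r * cmod \<zeta> < 1"
    using assms by (subst (asm) mult_less_cancel_right_pos) auto
  then show "cmod (of_real r * \<zeta>) < 1" using assms by (simp add: norm_mult)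
qed

lemma one_minus_notin_nonpos_Reals:
  assumes "cmod w < 1" shows "1 - w \<notin> \<real>\<^sub>\<le>\<^sub>0"
  using complex_Re_le_cmod[of w] assms by (auto simp: complex_nonpos_Reals_iff)

text \<open>The conjugate of the integrand extends holomorphically to a disc around the closed unit disc and
  vanishes at \<open>0\<close>.\<close>

lemma circle_mean_cnj_power_Cauchy:
  assumes r: "0 \<le> r" "r < (1::real)"
  shows "circle_mean (\<lambda>\<zeta>. cnj \<zeta> ^ Suc k / (1 - of_real r * cnj \<zeta>)) = 0"
proof -
  obtain R where R: "R > 1" "\<And>\<zeta>. \<zeta> \<in> ball 0 R \<Longrightarrow> cmod (of_real r * \<zeta>) < 1"
    by (rule poisson_radius[OF r]) blast
  have "circle_mean (\<lambda>\<zeta>. (\<zeta> ^ Suc k / (1 - of_real r * \<zeta>)) / (1 - 0 * cnj \<zeta>)) = 0 ^ Suc k / (1 - of_real r * 0)"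
  proof (rule circle_mean_Cauchy)
    show "(\<lambda>\<zeta>. \<zeta> ^ Suc k / (1 - of_real r * \<zeta>)) holomorphic_on ball 0 R"
      using R(2) by (intro holomorphic_intros) fastforce
  qed (use R in auto)
  with circle_mean_cnj[of "\<lambda>\<zeta>. \<zeta> ^ Suc k / (1 - of_real r * \<zeta>)"] show ?thesis by simp
qed

text \<open>The Poisson kernel of \<alpha>-harmonic functions at the point \<open>r\<close> and the boundary point \<open>\<zeta>\<close>, that is
  \<open>(1 - |w|\<^sup>2)\<^bsup>\<alpha> + 1\<^esup> / ((1 - w) (1 - cnj w)\<^bsup>\<alpha> + 1\<^esup>)\<close> for \<open>w = r cnj \<zeta>\<close>. For \<open>|\<zeta>| = 1\<close> only the
  denominator fails to be holomorphic in \<open>\<zeta>\<close>, and it is the one of the Cauchy kernel.\<close>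

definition alpha_kernel :: "real \<Rightarrow> real \<Rightarrow> complex \<Rightarrow> complex" where
  "alpha_kernel \<alpha> r \<zeta> = of_real ((1 - r\<^sup>2) powr (\<alpha> + 1)) *
     (1 - of_real r * \<zeta>) powr (- of_real (\<alpha> + 1)) / (1 - of_real r * cnj \<zeta>)"

lemma sphere_denominators:
  assumes "0 \<le> r" "r < (1::real)" "cmod \<zeta> = 1"
  shows "1 - of_real r * \<zeta> \<noteq> 0" "1 - of_real r * cnj \<zeta> \<noteq> 0" "1 - of_real r * \<zeta> \<notin> \<real>\<^sub>\<le>\<^sub>0"
proof -
  have c: "cmod (of_real r * \<zeta>) < 1" "cmod (of_real r * cnj \<zeta>) < 1" using assms by (auto simp: norm_mult)
  have nz: "1 - w \<noteq> 0" if "cmod w < 1" for w using that by auto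
  show "1 - of_real r * \<zeta> \<noteq> 0" by (rule nz[OF c(1)])
  show "1 - of_real r * cnj \<zeta> \<noteq> 0" by (rule nz[OF c(2)])
  show "1 - of_real r * \<zeta> \<notin> \<real>\<^sub>\<le>\<^sub>0" by (rule one_minus_notin_nonpos_Reals[OF c(1)])
qed

lemma alpha_kernel_continuous:
  assumes "0 \<le> r" "r < 1"
  shows "continuous_on (sphere 0 1) (alpha_kernel \<alpha> r)"
proof -
  have "(\<lambda>\<zeta>. (1 - of_real r * \<zeta>) powr (- of_real (\<alpha> + 1))) holomorphic_on sphere 0 1"
    using sphere_denominators(3)[OF assms] by (intro holomorphic_intros) simp_all
  from holomorphic_on_imp_continuous_on[OF this] show ?thesis
    unfolding alpha_kernel_def[abs_def] using sphere_denominators(2)[OF assms]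
    by (intro continuous_on_divide continuous_on_mult continuous_on_diff continuous_on_cnj
        continuous_on_const continuous_on_id) simp_all
qed

lemma alpha_kernel_holomorphic_mean:
  assumes r: "0 \<le> r" "r < 1" and u: "u holomorphic_on ball 0 R" "R > 1"
  shows "circle_mean (\<lambda>\<zeta>. alpha_kernel \<alpha> r \<zeta> * u \<zeta>) = u (of_real r)"
proof -
  obtain R' where R': "R' > 1" "\<And>\<zeta>. \<zeta> \<in> ball 0 R' \<Longrightarrow> cmod (of_real r * \<zeta>) < 1"
    by (rule poisson_radius[OF r]) blast
  define g where "g = (\<lambda>\<zeta>. of_real ((1 - r\<^sup>2) powr (\<alpha> + 1)) * (1 - of_real r * \<zeta>) powr (- of_real (\<alpha> + 1)) * u \<zeta>)"
  have "circle_mean (\<lambda>\<zeta>. g \<zeta> / (1 - of_real r * cnj \<zeta>)) = g (of_real r)"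
  proof (rule circle_mean_Cauchy)
    show "g holomorphic_on ball 0 (min R R')"
      unfolding g_def using R'(2) one_minus_notin_nonpos_Reals
      by (intro holomorphic_intros holomorphic_on_subset[OF u(1)]) auto
  qed (use R' u r in auto)
  moreover have "r\<^sup>2 < 1" using r by (simp add: abs_square_less_1)
  then have "of_real ((1 - r\<^sup>2) powr (\<alpha> + 1)) * (1 - of_real r * of_real r) powr (- of_real (\<alpha> + 1)) = (1::complex)"
    using powr_of_real[of "1 - r\<^sup>2" "- (\<alpha> + 1)"]
    by (simp add: power2_eq_square flip: of_real_mult powr_add)
  ultimately show ?thesis
    by (simp add: g_def alpha_kernel_def mult_ac)
qed

text \<open>Expand \<open>(1 - r \<zeta>)\<^bsup>-(\<alpha> + 1)\<^esup>\<close> in powers of \<open>\<zeta>\<close>. Against \<open>cnj \<zeta> ^ m\<close> and the Cauchy kernel the powers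
  below \<open>m\<close> have mean zero, and every other power \<open>j\<close> contributes \<open>r\<^bsup>j - m\<^esup>\<close>: what survives is the tail of
  the binomial series. The factor \<open>r\<^sup>m\<close> on the left avoids a division by \<open>r\<close>.\<close>

lemma alpha_kernel_cnj_power_mean:
  assumes r: "0 \<le> r" "r < 1"
  shows "circle_mean (\<lambda>\<zeta>. alpha_kernel \<alpha> r \<zeta> * cnj \<zeta> ^ m) * of_real r ^ m = of_real (binom_tail \<alpha> m (r\<^sup>2))"
proof -
  define C where "C = complex_of_real ((1 - r\<^sup>2) powr (\<alpha> + 1))"
  define e where "e = (\<lambda>j \<zeta>. \<zeta> ^ j * cnj \<zeta> ^ m / (1 - of_real r * cnj \<zeta>))"
  define u where "u = (\<lambda>j \<zeta>. C * of_real (binom_coeff \<alpha> j) * of_real r ^ j * e j \<zeta>)"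
  have r2: "r\<^sup>2 < 1" "r * r < 1" using r by (simp_all add: abs_square_less_1 flip: power2_eq_square)
  have e_mean: "circle_mean (e j) * of_real r ^ m = (if j < m then 0 else of_real r ^ j)" for j
  proof (cases "j < m")
    case True
    then obtain k where m: "m = j + Suc k" using less_imp_Suc_add by (metis add_Suc_right)
    have "circle_mean (e j) = circle_mean (\<lambda>\<zeta>. cnj \<zeta> ^ Suc k / (1 - of_real r * cnj \<zeta>))"
    proof (rule circle_mean_cong)
      fix \<zeta> :: complex assume "cmod \<zeta> = 1"
      then have "\<zeta> ^ j * cnj \<zeta> ^ j = 1"
        by (simp add: complex_norm_square[symmetric] flip: power_mult_distrib)
      then show "e j \<zeta> = cnj \<zeta> ^ Suc k / (1 - of_real r * cnj \<zeta>)"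
        unfolding e_def m power_add by (metis mult.assoc mult_1)
    qed
    with True show ?thesis by (simp only: circle_mean_cnj_power_Cauchy[OF r]) simp
  next
    case False
    then obtain k where j: "j = m + k" using le_Suc_ex not_less by blast
    have "circle_mean (e j) = circle_mean (\<lambda>\<zeta>. \<zeta> ^ k / (1 - of_real r * cnj \<zeta>))"
    proof (rule circle_mean_cong)
      fix \<zeta> :: complex assume "cmod \<zeta> = 1"
      then have "\<zeta> ^ m * cnj \<zeta> ^ m = 1"
        by (simp add: complex_norm_square[symmetric] flip: power_mult_distrib)
      then show "e j \<zeta> = \<zeta> ^ k / (1 - of_real r * cnj \<zeta>)"
        unfolding e_def j power_add by (metis mult.assoc mult.commute mult_1)
    qed
    also have "\<dots> = of_real r ^ k"
      using r by (intro circle_mean_Cauchy[of _ 2]) (auto intro!: holomorphic_intros)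
    finally show ?thesis using False by (simp add: j power_add mult.commute)
  qed
  have "(\<lambda>j. circle_mean (u j)) sums circle_mean (\<lambda>\<zeta>. \<Sum>j. u j \<zeta>)"
  proof (rule circle_mean_sums)
    show "continuous_on (sphere 0 1) (u j)" for j
      unfolding u_def e_def using sphere_denominators[OF r] by (intro continuous_intros) auto
    \<comment> \<open>Convergence at a radius between \<open>r\<close> and \<open>1\<close> gives absolute convergence at \<open>r\<close>.\<close>
    define s where "s = (1 + r) / 2"
    have s: "r < s" "s < 1" using r by (auto simp: s_def)
    have "summable (\<lambda>j. of_real (binom_coeff \<alpha> j) * complex_of_real s ^ j)"
      using binom_coeff_sums[of "of_real s" \<alpha>] s r by (simp add: sums_iff)
    from powser_insidea[OF this, of "of_real r"] s r
    have "summable (\<lambda>j. norm (binom_coeff \<alpha> j) * r ^ j)"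
      by (simp add: norm_mult norm_power)
    then show "summable (\<lambda>j. norm C * (norm (binom_coeff \<alpha> j) * r ^ j) * (1 / (1 - r)))"
      by (intro summable_mult summable_mult2)
    fix j and \<zeta> :: complex assume \<zeta>: "cmod \<zeta> = 1"
    have "1 - r \<le> cmod (1 - of_real r * cnj \<zeta>)"
      using norm_triangle_ineq2[of 1 "of_real r * cnj \<zeta>"] \<zeta> r by (simp add: norm_mult)
    then have "cmod (e j \<zeta>) \<le> 1 / (1 - r)"
      unfolding e_def norm_divide norm_mult norm_power complex_mod_cnj \<zeta>
      using r by (intro frac_le) auto
    then have "norm C * (norm (binom_coeff \<alpha> j) * r ^ j) * cmod (e j \<zeta>)
       \<le> norm C * (norm (binom_coeff \<alpha> j) * r ^ j) * (1 / (1 - r))"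
      using r by (intro mult_left_mono) auto
    then show "norm (u j \<zeta>) \<le> norm C * (norm (binom_coeff \<alpha> j) * r ^ j) * (1 / (1 - r))"
      using r by (simp add: u_def norm_mult norm_power mult.assoc)
  qed
  moreover have "circle_mean (\<lambda>\<zeta>. \<Sum>j. u j \<zeta>) = circle_mean (\<lambda>\<zeta>. alpha_kernel \<alpha> r \<zeta> * cnj \<zeta> ^ m)"
  proof (rule circle_mean_cong)
    fix \<zeta> :: complex assume \<zeta>: "cmod \<zeta> = 1"
    have "(\<lambda>j. of_real (binom_coeff \<alpha> j) * (of_real r * \<zeta>) ^ j) sums (1 - of_real r * \<zeta>) powr (- of_real (\<alpha> + 1))"
      using \<zeta> r by (intro binom_coeff_sums) (simp add: norm_mult)
    from sums_mult[OF this, of "C * cnj \<zeta> ^ m / (1 - of_real r * cnj \<zeta>)"]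
    have "(\<lambda>j. u j \<zeta>) sums (C * cnj \<zeta> ^ m / (1 - of_real r * cnj \<zeta>) * (1 - of_real r * \<zeta>) powr (- of_real (\<alpha> + 1)))"
      by (simp add: u_def e_def power_mult_distrib mult_ac)
    then show "(\<Sum>j. u j \<zeta>) = alpha_kernel \<alpha> r \<zeta> * cnj \<zeta> ^ m"
      by (simp add: alpha_kernel_def C_def sums_iff mult_ac)
  qed
  moreover have "circle_mean (u j) = C * of_real (binom_coeff \<alpha> j) * of_real r ^ j * circle_mean (e j)" for j
    unfolding u_def by (rule circle_mean_mult)
  ultimately have "(\<lambda>j. C * of_real (binom_coeff \<alpha> j) * of_real r ^ j * circle_mean (e j)) sums
      circle_mean (\<lambda>\<zeta>. alpha_kernel \<alpha> r \<zeta> * cnj \<zeta> ^ m)" by simp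
  from sums_mult2[OF this, of "of_real r ^ m"]
  have S1: "(\<lambda>j. C * of_real (binom_coeff \<alpha> j) * of_real r ^ j * (if j < m then 0 else of_real r ^ j)) sums
      (circle_mean (\<lambda>\<zeta>. alpha_kernel \<alpha> r \<zeta> * cnj \<zeta> ^ m) * of_real r ^ m)"
    by (simp only: mult.assoc e_mean)
  have "(\<lambda>j. C * (of_real (binom_coeff \<alpha> j) * of_real (r\<^sup>2) ^ j)) sums (C * (1 - of_real (r\<^sup>2)) powr (- of_real (\<alpha> + 1)))"
    using r2 by (intro sums_mult binom_coeff_sums) (simp add: norm_power)
  also have "C * (1 - of_real (r\<^sup>2)) powr (- of_real (\<alpha> + 1)) = 1"
    using r2 powr_of_real[of "1 - r\<^sup>2" "- (\<alpha> + 1)"]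
    by (simp add: C_def flip: of_real_mult powr_add)
  finally have "(\<lambda>j. C * (of_real (binom_coeff \<alpha> j) * of_real (r\<^sup>2) ^ j)
        - (if j \<in> {..<m} then C * (of_real (binom_coeff \<alpha> j) * of_real (r\<^sup>2) ^ j) else 0)) sums
      (1 - (\<Sum>j<m. C * (of_real (binom_coeff \<alpha> j) * of_real (r\<^sup>2) ^ j)))"
    by (intro sums_diff sums_If_finite_set) auto
  also have "(\<lambda>j. C * (of_real (binom_coeff \<alpha> j) * of_real (r\<^sup>2) ^ j)
        - (if j \<in> {..<m} then C * (of_real (binom_coeff \<alpha> j) * of_real (r\<^sup>2) ^ j) else 0))
      = (\<lambda>j. C * of_real (binom_coeff \<alpha> j) * of_real r ^ j * (if j < m then 0 else of_real r ^ j))"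
    by (auto simp: fun_eq_iff power2_eq_square power_mult_distrib)
  also have "1 - (\<Sum>j<m. C * (of_real (binom_coeff \<alpha> j) * of_real (r\<^sup>2) ^ j)) = of_real (binom_tail \<alpha> m (r\<^sup>2))"
    by (simp add: binom_tail_def C_def sum_distrib_left)
  finally show ?thesis using S1 sums_unique2 by blast
qed

section \<open>The Poisson representation as a limit of means\<close>

lemma circle_mean_diff:
  assumes "continuous_on (sphere 0 1) u" "continuous_on (sphere 0 1) v"
  shows "circle_mean (\<lambda>\<zeta>. u \<zeta> - v \<zeta>) = circle_mean u - circle_mean v"
  unfolding circle_mean_def
  by (subst integral_diff)
     (use assms in \<open>auto intro!: integrable_continuous_interval continuous_on_cis_comp simp: diff_divide_distrib\<close>)

lemma continuous_on_dilated:
  fixes f :: "complex \<Rightarrow> complex"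
  assumes "continuous_on (ball 0 1) f" and \<rho>: "0 \<le> \<rho>" "\<rho> < (1::real)"
  shows "continuous_on (sphere 0 1) (\<lambda>\<zeta>. f (of_real \<rho> * \<zeta>))"
  by (rule continuous_on_compose2[OF assms(1)]) (use \<rho> in \<open>auto intro!: continuous_intros simp: norm_mult\<close>)

text \<open>For \<open>\<rho> < 1\<close> the expansion of the dilate converges uniformly on the unit circle, so the mean against the
  kernel is computed mode by mode; the holomorphic part is reproduced exactly.\<close>

lemma expansion_alpha_kernel_mean:
  assumes E: "has_expansion \<alpha> f H \<beta>" and r: "0 \<le> r" "r < 1" and \<rho>: "0 \<le> \<rho>" "\<rho> < 1"
  shows "(\<lambda>n. \<beta> n * of_real (\<rho> ^ Suc n * radial \<alpha> n (\<rho>\<^sup>2)) * circle_mean (\<lambda>\<zeta>. alpha_kernel \<alpha> r \<zeta> * cnj \<zeta> ^ Suc n))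
     sums (circle_mean (\<lambda>\<zeta>. alpha_kernel \<alpha> r \<zeta> * f (of_real \<rho> * \<zeta>)) - H (of_real (\<rho> * r)))"
proof -
  define K where "K = alpha_kernel \<alpha> r"
  define c where "c = (\<lambda>n. \<beta> n * of_real (\<rho> ^ Suc n * radial \<alpha> n (\<rho>\<^sup>2)))"
  have contK: "continuous_on (sphere 0 1) K"
    unfolding K_def by (rule alpha_kernel_continuous[OF r])
  then obtain C where C: "\<And>\<zeta>. cmod \<zeta> = 1 \<Longrightarrow> cmod (K \<zeta>) \<le> C" "0 \<le> C"
  proof -
    have "compact (K ` sphere 0 1)" by (intro compact_continuous_image contK) auto
    then obtain C where "\<And>x. x \<in> K ` sphere 0 1 \<Longrightarrow> norm x \<le> C" using compact_imp_bounded bounded_iff by metis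
    then have *: "cmod (K \<zeta>) \<le> C" if "cmod \<zeta> = 1" for \<zeta> using that by auto
    have "0 \<le> C" using order_trans[OF norm_ge_zero *[of 1]] by simp
    with * show ?thesis by (rule that)
  qed
  have \<rho>2: "0 \<le> \<rho>\<^sup>2" "\<rho>\<^sup>2 < 1" using \<rho> by (auto simp: abs_square_less_1)
  have disc: "of_real \<rho> * \<zeta> \<in> ball 0 1" if "cmod \<zeta> = 1" for \<zeta> using that \<rho> by (simp add: norm_mult)
  have "(\<lambda>n. circle_mean (\<lambda>\<zeta>. c n * (K \<zeta> * cnj \<zeta> ^ Suc n))) sums
      circle_mean (\<lambda>\<zeta>. \<Sum>n. c n * (K \<zeta> * cnj \<zeta> ^ Suc n))"
  proof (rule circle_mean_sums)
    show "continuous_on (sphere 0 1) (\<lambda>\<zeta>. c n * (K \<zeta> * cnj \<zeta> ^ Suc n))" for n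
      by (intro continuous_intros contK)
    have "summable (\<lambda>n. norm (\<beta> n) * \<rho> ^ n)" using E \<rho> unfolding has_expansion_def by blast
    then show "summable (\<lambda>n. norm (\<beta> n) * \<rho> ^ n * (1 + (1 - \<rho>\<^sup>2) powr \<alpha>) * C)"
      by (intro summable_mult2)
    fix n and \<zeta> :: complex assume \<zeta>: "cmod \<zeta> = 1"
    have "\<rho> ^ Suc n \<le> \<rho> ^ n" using \<rho> by (intro power_decreasing) auto
    moreover have "0 \<le> radial \<alpha> n (\<rho>\<^sup>2)" "radial \<alpha> n (\<rho>\<^sup>2) \<le> 1 + (1 - \<rho>\<^sup>2) powr \<alpha>"
      by (intro radial_nonneg radial_le \<rho>2)+
    moreover have "cmod (c n) = norm (\<beta> n) * \<rho> ^ Suc n * radial \<alpha> n (\<rho>\<^sup>2)"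
      using \<rho> calculation(2) unfolding c_def norm_mult norm_of_real abs_mult by simp
    ultimately have "cmod (c n) \<le> norm (\<beta> n) * \<rho> ^ n * (1 + (1 - \<rho>\<^sup>2) powr \<alpha>)"
      using \<rho> by (simp only:) (intro mult_mono mult_nonneg_nonneg, auto)
    moreover have "cmod (K \<zeta> * cnj \<zeta> ^ Suc n) \<le> C"
      unfolding norm_mult norm_power complex_mod_cnj \<zeta> using C(1)[OF \<zeta>] by simp
    ultimately show "norm (c n * (K \<zeta> * cnj \<zeta> ^ Suc n)) \<le> norm (\<beta> n) * \<rho> ^ n * (1 + (1 - \<rho>\<^sup>2) powr \<alpha>) * C"
      using C(2) \<rho> unfolding norm_mult[of "c n"]
      by (intro mult_mono) (auto intro!: mult_nonneg_nonneg add_nonneg_nonneg)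
  qed
  moreover have "circle_mean (\<lambda>\<zeta>. \<Sum>n. c n * (K \<zeta> * cnj \<zeta> ^ Suc n)) =
      circle_mean (\<lambda>\<zeta>. K \<zeta> * f (of_real \<rho> * \<zeta>) - K \<zeta> * H (of_real \<rho> * \<zeta>))"
  proof (rule circle_mean_cong)
    fix \<zeta> :: complex assume \<zeta>: "cmod \<zeta> = 1"
    have "(\<lambda>n. \<beta> n * cnj (of_real \<rho> * \<zeta>) ^ Suc n * of_real (radial \<alpha> n ((cmod (of_real \<rho> * \<zeta>))\<^sup>2)))
        sums (f (of_real \<rho> * \<zeta>) - H (of_real \<rho> * \<zeta>))"
      using E disc[OF \<zeta>] unfolding has_expansion_def by blast
    from sums_mult[OF this, of "K \<zeta>"]
    have "(\<lambda>n. c n * (K \<zeta> * cnj \<zeta> ^ Suc n)) sums (K \<zeta> * (f (of_real \<rho> * \<zeta>) - H (of_real \<rho> * \<zeta>)))"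
      by (simp add: c_def \<zeta> norm_mult power_mult_distrib mult_ac)
    then show "(\<Sum>n. c n * (K \<zeta> * cnj \<zeta> ^ Suc n)) = K \<zeta> * f (of_real \<rho> * \<zeta>) - K \<zeta> * H (of_real \<rho> * \<zeta>)"
      by (simp add: sums_iff right_diff_distrib)
  qed
  moreover have "\<dots> = circle_mean (\<lambda>\<zeta>. K \<zeta> * f (of_real \<rho> * \<zeta>)) - circle_mean (\<lambda>\<zeta>. K \<zeta> * H (of_real \<rho> * \<zeta>))"
    using E unfolding has_expansion_def
    by (intro circle_mean_diff continuous_on_mult contK continuous_on_dilated \<rho>)
       (auto intro: holomorphic_on_imp_continuous_on)
  moreover have "circle_mean (\<lambda>\<zeta>. K \<zeta> * H (of_real \<rho> * \<zeta>)) = H (of_real (\<rho> * r))"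
  proof -
    obtain R where R: "R > 1" "\<And>\<zeta>. \<zeta> \<in> ball 0 R \<Longrightarrow> cmod (of_real \<rho> * \<zeta>) < 1"
      by (rule poisson_radius[OF \<rho>]) blast
    have "(\<lambda>\<zeta>. H (of_real \<rho> * \<zeta>)) holomorphic_on ball 0 R"
      using E R(2)
      by (intro holomorphic_on_compose_gen[of "\<lambda>\<zeta>. of_real \<rho> * \<zeta>" _ H "ball 0 1", unfolded o_def] holomorphic_intros)
         (auto simp: has_expansion_def)
    from alpha_kernel_holomorphic_mean[OF r this R(1), of \<alpha>] show ?thesis by (simp add: K_def)
  qed
  ultimately show ?thesis by (simp add: circle_mean_mult c_def K_def)
qed

text \<open>At \<open>r = 0\<close> the kernel is constant and all the modes have mean zero.\<close>

lemma expansion_mean_value: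
  assumes E: "has_expansion \<alpha> f H \<beta>" and \<rho>: "0 \<le> \<rho>" "\<rho> < 1"
  shows "circle_mean (\<lambda>\<zeta>. f (of_real \<rho> * \<zeta>)) = f 0"
proof -
  have K: "alpha_kernel \<alpha> 0 = (\<lambda>_. 1)" by (simp add: alpha_kernel_def fun_eq_iff)
  have "circle_mean (\<lambda>\<zeta>. cnj \<zeta> ^ Suc n) = 0" for n
    using circle_mean_cnj_power_Cauchy[of 0 n] by simp
  with expansion_alpha_kernel_mean[OF E order_refl zero_less_one \<rho>]
  have "circle_mean (\<lambda>\<zeta>. f (of_real \<rho> * \<zeta>)) = H 0"
    by (simp add: K sums_iff del: power_Suc)
  moreover have "(\<lambda>n. \<beta> n * cnj 0 ^ Suc n * of_real (radial \<alpha> n ((cmod 0)\<^sup>2))) sums (f 0 - H 0)"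
    using E unfolding has_expansion_def by (metis centre_in_ball zero_less_one)
  ultimately show ?thesis by (simp add: sums_iff)
qed

text \<open>Each mode of the mean at radius \<open>\<rho>\<close> is the corresponding mode \<open>b n\<close> of \<open>f r\<close> multiplied by the value of
  \<open>binom_tail\<close> at \<open>\<rho>\<^sup>2\<close> over \<open>\<rho>\<^bsup>n + 1\<^esup>\<close>, which tends to \<open>1\<close>. Only \<open>\<rho> > sqrt r\<close> matters. There the factor
  is at most \<open>(sqrt r)\<^bsup>-(n + 1)\<^esup>\<close>, which leaves a majorant of geometric ratio \<open>sqrt r < 1\<close> and allows the
  limit to be taken term by term.\<close>

lemma expansion_poisson_limit:
  assumes E: "has_expansion \<alpha> f H \<beta>" and \<alpha>: "\<alpha> > -1" and r: "0 < r" "r < 1"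
  shows "((\<lambda>\<rho>. circle_mean (\<lambda>\<zeta>. alpha_kernel \<alpha> r \<zeta> * f (of_real \<rho> * \<zeta>))) \<longlongrightarrow> f (of_real r)) (at_left 1)"
proof -
  define b where "b = (\<lambda>n. \<beta> n * of_real (r ^ Suc n * radial \<alpha> n (r\<^sup>2)))"
  define a where "a = (\<lambda>n \<rho>. b n * of_real (binom_tail \<alpha> (Suc n) (\<rho>\<^sup>2) / \<rho> ^ Suc n))"
  define M where "M = (\<lambda>n. (1 + (1 - r\<^sup>2) powr \<alpha>) * sqrt r * (norm (\<beta> n) * sqrt r ^ n))"
  define F where "F = (\<lambda>\<rho>. circle_mean (\<lambda>\<zeta>. alpha_kernel \<alpha> r \<zeta> * f (of_real \<rho> * \<zeta>)))"
  have r2: "0 \<le> r\<^sup>2" "r\<^sup>2 < 1" using r by (auto simp: abs_square_less_1)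
  have sqr: "0 < sqrt r" "sqrt r < 1" using r by auto
  have near1: "\<forall>\<^sub>F \<rho> in at_left (1::real). sqrt r < \<rho> \<and> \<rho> < 1"
    using sqr eventually_at_left_real[of "sqrt r" 1] by auto
  have sums: "(\<lambda>n. a n \<rho>) sums (F \<rho> - H (of_real (\<rho> * r)))" if \<rho>: "0 < \<rho>" "\<rho> < 1" for \<rho>
  proof -
    have \<rho>2: "0 \<le> \<rho>\<^sup>2" "\<rho>\<^sup>2 < 1" using \<rho> by (auto simp: abs_square_less_1)
    have "\<beta> n * of_real (\<rho> ^ Suc n * radial \<alpha> n (\<rho>\<^sup>2)) * circle_mean (\<lambda>\<zeta>. alpha_kernel \<alpha> r \<zeta> * cnj \<zeta> ^ Suc n) = a n \<rho>" for n
    proof -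
      define N where "N = real (Suc n) * binom_coeff \<alpha> (Suc n)"
      have N: "N > 0" using binom_coeff_pos[OF \<alpha>] by (simp add: N_def)
      have "circle_mean (\<lambda>\<zeta>. alpha_kernel \<alpha> r \<zeta> * cnj \<zeta> ^ Suc n) * of_real r ^ Suc n
          = of_real (N * (r\<^sup>2) ^ Suc n * radial \<alpha> n (r\<^sup>2))"
        unfolding N_def radial_tail[OF r2] using r by (intro alpha_kernel_cnj_power_mean) auto
      also have "\<dots> = of_real (N * r ^ Suc n * radial \<alpha> n (r\<^sup>2)) * of_real r ^ Suc n"
        by (simp add: power2_eq_square power_mult_distrib del: power_Suc)
      finally have "circle_mean (\<lambda>\<zeta>. alpha_kernel \<alpha> r \<zeta> * cnj \<zeta> ^ Suc n) = of_real (N * r ^ Suc n * radial \<alpha> n (r\<^sup>2))"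
        using r by (subst (asm) mult_right_cancel) auto
      moreover have "binom_tail \<alpha> (Suc n) (\<rho>\<^sup>2) = N * \<rho> ^ Suc n * \<rho> ^ Suc n * radial \<alpha> n (\<rho>\<^sup>2)"
        using radial_tail[OF \<rho>2, of n \<alpha>] by (simp add: N_def power2_eq_square power_mult_distrib del: power_Suc of_nat_Suc)
      then have "binom_tail \<alpha> (Suc n) (\<rho>\<^sup>2) / \<rho> ^ Suc n = N * \<rho> ^ Suc n * radial \<alpha> n (\<rho>\<^sup>2)"
        using \<rho> by simp
      ultimately show ?thesis by (simp only: a_def b_def of_real_mult mult_ac)
    qed
    with expansion_alpha_kernel_mean[OF E _ r(2) _ \<rho>(2)] r \<rho> show ?thesis by (simp add: F_def)
  qed
  have "((\<lambda>\<rho>. suminf (\<lambda>n. a n \<rho>)) \<longlongrightarrow> suminf b) (at_left 1)"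
  proof (rule tannerys_theorem[THEN conjunct2, THEN conjunct2])
    show "((\<lambda>\<rho>. a n \<rho>) \<longlongrightarrow> b n) (at_left 1)" for n
    proof -
      have "filterlim (\<lambda>\<rho>::real. \<rho>\<^sup>2) (at_left 1) (at_left 1)"
        unfolding filterlim_at
      proof
        show "\<forall>\<^sub>F \<rho> in at_left (1::real). \<rho>\<^sup>2 \<in> {..<1} \<and> \<rho>\<^sup>2 \<noteq> 1"
          using near1
        proof eventually_elim
          case (elim \<rho>)
          then have "\<bar>\<rho>\<bar> < 1" using sqr by linarith
          then have "\<rho>\<^sup>2 < 1" by (simp add: abs_square_less_1)
          then show ?case by simp
        qed
      qed (auto intro!: tendsto_eq_intros)
      from filterlim_compose[OF binom_tail_tendsto_1[OF \<alpha>] this]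
      have "((\<lambda>\<rho>. a n \<rho>) \<longlongrightarrow> b n * of_real (1 / 1 ^ Suc n)) (at_left 1)"
        unfolding a_def by (intro tendsto_intros) auto
      then show ?thesis by simp
    qed
    have "norm (a n \<rho>) \<le> M n" if \<rho>: "sqrt r < \<rho>" "\<rho> < 1" for n \<rho>
    proof -
      have \<rho>0: "0 < \<rho>" using sqr \<rho> by linarith
      have \<rho>2: "0 \<le> \<rho>\<^sup>2" "\<rho>\<^sup>2 < 1" using \<rho> \<rho>0 by (auto simp: abs_square_less_1)
      have "sqrt r ^ Suc n \<le> \<rho> ^ Suc n" using \<rho> sqr by (intro power_mono) auto
      also have "\<dots> \<le> \<bar>\<rho> ^ Suc n\<bar>" by (rule abs_ge_self)
      finally have "\<bar>binom_tail \<alpha> (Suc n) (\<rho>\<^sup>2) / \<rho> ^ Suc n\<bar> \<le> 1 / sqrt r ^ Suc n"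
        using binom_tail_le_1[OF \<alpha> \<rho>2(1), of "Suc n"] binom_tail_nonneg[OF \<alpha> \<rho>2, of n] sqr
        unfolding abs_divide
        by (intro frac_le) (auto simp del: power_Suc)
      moreover have "norm (b n) \<le> norm (\<beta> n) * (r ^ Suc n * (1 + (1 - r\<^sup>2) powr \<alpha>))"
        using radial_nonneg[OF r2, of \<alpha> n] radial_le[OF r2, of \<alpha> n] r
        unfolding b_def norm_mult norm_of_real abs_mult
        by (intro mult_left_mono) (auto simp del: power_Suc)
      ultimately have "norm (a n \<rho>) \<le> norm (\<beta> n) * (r ^ Suc n * (1 + (1 - r\<^sup>2) powr \<alpha>)) * (1 / sqrt r ^ Suc n)"
        unfolding a_def norm_mult[of "b n"] norm_of_real
        by (intro mult_mono) (use r in \<open>auto intro!: mult_nonneg_nonneg add_nonneg_nonneg\<close>)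
      also have "r ^ Suc n = sqrt r ^ Suc n * sqrt r ^ Suc n"
        using r by (simp flip: power_mult_distrib del: power_Suc)
      also have "norm (\<beta> n) * (sqrt r ^ Suc n * sqrt r ^ Suc n * (1 + (1 - r\<^sup>2) powr \<alpha>)) * (1 / sqrt r ^ Suc n) = M n"
        using sqr by (simp add: M_def)
      finally show ?thesis .
    qed
    then have "\<forall>\<^sub>F \<rho> in at_left 1. \<forall>n. norm (a n \<rho>) \<le> M n"
      using near1 by (auto elim: eventually_mono)
    then have "\<forall>\<^sub>F (k :: nat, \<rho>) in at_top \<times>\<^sub>F at_left 1. \<forall>n. norm (a n \<rho>) \<le> M n"
      by (simp add: eventually_prod2)
    then show "\<forall>\<^sub>F (n, \<rho>) in at_top \<times>\<^sub>F at_left 1. norm (a n \<rho>) \<le> M n"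
      by (rule eventually_mono) auto
    show "summable M"
      unfolding M_def using E sqr by (intro summable_mult) (auto simp: has_expansion_def)
  qed simp
  moreover have "\<forall>\<^sub>F \<rho> in at_left 1. suminf (\<lambda>n. a n \<rho>) = F \<rho> - H (of_real (\<rho> * r))"
    using near1
  proof eventually_elim
    case (elim \<rho>)
    with sums[of \<rho>] sqr show ?case by (simp add: sums_iff)
  qed
  ultimately have "((\<lambda>\<rho>. F \<rho> - H (of_real (\<rho> * r))) \<longlongrightarrow> suminf b) (at_left 1)"
    by (rule Lim_transform_eventually)
  moreover have "((\<lambda>\<rho>. H (of_real (\<rho> * r))) \<longlongrightarrow> H (of_real (1 * r))) (at_left 1)"
  proof (rule isCont_tendsto_compose[of _ H])
    have "continuous_on (ball 0 1) H"
      using E by (auto simp: has_expansion_def intro: holomorphic_on_imp_continuous_on)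
    then show "isCont H (of_real (1 * r))"
      using r by (simp add: continuous_on_eq_continuous_at)
  qed (intro tendsto_intros)
  ultimately have "((\<lambda>\<rho>. (F \<rho> - H (of_real (\<rho> * r))) + H (of_real (\<rho> * r))) \<longlongrightarrow> suminf b + H (of_real (1 * r))) (at_left 1)"
    by (rule tendsto_add)
  moreover have "suminf b = f (of_real r) - H (of_real r)"
  proof -
    have "of_real r \<in> ball (0::complex) 1" using r by simp
    then have "(\<lambda>n. \<beta> n * cnj (of_real r) ^ Suc n * of_real (radial \<alpha> n ((cmod (of_real r))\<^sup>2))) sums
        (f (of_real r) - H (of_real r))"
      using E unfolding has_expansion_def by blast
    then show ?thesis using r by (simp add: b_def sums_iff mult_ac)
  qed
  ultimately show ?thesis by (simp add: F_def)
qed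

section \<open>Estimates of the kernel and the theorem\<close>

lemma circle_mean_norm_le:
  assumes u: "continuous_on (sphere 0 1) u" and b: "(b has_integral I) {0..2 * pi}"
    and le: "\<And>t. t \<in> {0..2 * pi} \<Longrightarrow> cmod (u (cis t)) \<le> b t"
  shows "cmod (circle_mean u) \<le> I / (2 * pi)"
proof -
  have "cmod (integral {0..2 * pi} (\<lambda>t. u (cis t))) \<le> integral {0..2 * pi} b"
    by (rule integral_norm_bound_integral[OF integrable_continuous_interval[OF continuous_on_cis_comp[OF u]]
          has_integral_integrable[OF b] le])
  then show ?thesis
    using integral_unique[OF b] by (simp add: circle_mean_def norm_divide norm_mult divide_right_mono)
qed

text \<open>The classical Poisson kernel of the unit disc at \<open>r\<close>, in the angle \<open>t\<close> of the boundary point.\<close>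

definition poisson :: "real \<Rightarrow> real \<Rightarrow> real" where
  "poisson r t = (1 - r\<^sup>2) / (1 - 2 * r * cos t + r\<^sup>2)"

lemma poisson_denominator:
  fixes r t :: real
  assumes "0 \<le> r" "r < 1"
  shows "0 < 1 - 2 * r * cos t + r\<^sup>2"
proof -
  have "2 * r * cos t \<le> 2 * r * 1" using assms by (intro mult_left_mono) auto
  moreover have "0 < (1 - r)\<^sup>2" using assms by simp
  ultimately show ?thesis by (simp add: power2_eq_square algebra_simps)
qed

text \<open>The second term is twice the imaginary part of \<open>- Ln (1 - r cis t)\<close>. Unlike the half-angle substitution,
  this primitive is smooth on the whole line.\<close>

definition poisson_primitive :: "real \<Rightarrow> real \<Rightarrow> real" where
  "poisson_primitive r t = t + 2 * arctan (r * sin t / (1 - r * cos t))"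

lemma poisson_primitive_deriv:
  assumes r: "0 \<le> r" "r < 1"
  shows "(poisson_primitive r has_real_derivative poisson r t) (at t)"
proof -
  define c where "c = 1 - r * cos t"
  have c: "c > 0" using mult_left_mono[of "cos t" 1 r] r by (simp add: c_def) 
  define d where "d = 1 - 2 * r * cos t + r\<^sup>2"
  have d: "d > 0" unfolding d_def by (rule poisson_denominator[OF r])
  have cd: "c\<^sup>2 + (r * sin t)\<^sup>2 = d"
    by (simp add: c_def d_def power_mult_distrib power2_diff sin_squared_eq algebra_simps)
  have "((\<lambda>t. r * sin t / (1 - r * cos t)) has_real_derivative
      (r * cos t * c - r * sin t * (r * sin t)) / (c * c)) (at t)"
    using c unfolding c_def by (auto intro!: derivative_eq_intros)
  from DERIV_add[OF DERIV_ident DERIV_cmult[OF DERIV_chain2[OF DERIV_arctan this], of 2]]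
  have "(poisson_primitive r has_real_derivative
      1 + 2 * (inverse (1 + (r * sin t / c)\<^sup>2) * ((r * cos t * c - r * sin t * (r * sin t)) / (c * c)))) (at t)"
    unfolding poisson_primitive_def[abs_def] c_def by simp
  also have "1 + (r * sin t / c)\<^sup>2 = d / c\<^sup>2"
    using c by (simp add: cd[symmetric] power_divide field_simps)
  also have "1 + 2 * (inverse (d / c\<^sup>2) * ((r * cos t * c - r * sin t * (r * sin t)) / (c * c)))
      = (d + 2 * (r * cos t * c - r * sin t * (r * sin t))) / d"
    using c d by (simp add: field_simps power2_eq_square)
  also have "r * cos t * c - r * sin t * (r * sin t) = r * cos t - r\<^sup>2"
  proof -
    have "r * cos t * c - r * sin t * (r * sin t) = r * cos t - r\<^sup>2 * ((sin t)\<^sup>2 + (cos t)\<^sup>2)"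
      unfolding c_def
      by (simp add: power2_eq_square algebra_simps
          del: sin_cos_squared_add sin_cos_squared_add2 sin_cos_squared_add3)
    then show ?thesis by simp
  qed
  also have "(d + 2 * (r * cos t - r\<^sup>2)) / d = poisson r t"
    by (simp add: d_def poisson_def)
  finally show ?thesis .
qed

lemma poisson_has_integral:
  assumes "0 \<le> r" "r < 1" "a \<le> b"
  shows "(poisson r has_integral poisson_primitive r b - poisson_primitive r a) {a..b}"
  using assms poisson_primitive_deriv[OF assms(1,2)]
  by (intro fundamental_theorem_of_calculus)
     (auto simp flip: has_real_derivative_iff_has_vector_derivative intro: has_field_derivative_at_within)

lemma cos_3pi_half: "cos (3 * pi / 2) = 0" "sin (3 * pi / 2) = -1"
  using cos_add[of pi "pi / 2"] sin_add[of pi "pi / 2"] by (simp_all add: field_simps)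

lemma poisson_primitive_values:
  "poisson_primitive r 0 = 0" "poisson_primitive r (2 * pi) = 2 * pi"
  "poisson_primitive r (pi / 2) = pi / 2 + 2 * arctan r"
  "poisson_primitive r (3 * pi / 2) = 3 * pi / 2 - 2 * arctan r"
  by (simp_all add: poisson_primitive_def cos_3pi_half arctan_minus)

text \<open>The Poisson kernel is above its value at \<open>\<plusminus>\<pi>/2\<close> where the cosine is positive and below where it is
  negative. The intervals on
  which the cosine has constant sign are integrated with the primitive; the two signs occur on sets of equal
  length, so the constants cancel.\<close>

lemma poisson_deviation_integral:
  assumes r: "0 \<le> r" "r < 1"
  shows "((\<lambda>t. \<bar>poisson r t - (1 - r\<^sup>2) / (1 + r\<^sup>2)\<bar>) has_integral 8 * arctan r) {0..2 * pi}"
proof -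
  define c where "c = (1 - r\<^sup>2) / (1 + r\<^sup>2)"
  have r2: "0 \<le> 1 - r\<^sup>2" using r by (simp add: power_le_one)
  have ge: "c \<le> poisson r t" if "0 \<le> cos t" for t
    unfolding c_def poisson_def
    by (intro divide_left_mono) (use r2 r that poisson_denominator[OF r, of t] in \<open>auto intro!: mult_pos_pos add_pos_nonneg\<close>)
  have le: "poisson r t \<le> c" if "cos t \<le> 0" for t
    unfolding c_def poisson_def
    by (intro divide_left_mono) (use r2 r that poisson_denominator[OF r, of t] in
      \<open>auto intro!: mult_pos_pos add_pos_nonneg mult_nonneg_nonpos\<close>)
  have plus: "((\<lambda>t. \<bar>poisson r t - c\<bar>) has_integral
      (poisson_primitive r b - poisson_primitive r a) - (b - a) * c) {a..b}"
    if "a \<le> b" "\<And>t. t \<in> {a..b} \<Longrightarrow> 0 \<le> cos t" for a b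
  proof -
    have "((\<lambda>t. poisson r t - c) has_integral (poisson_primitive r b - poisson_primitive r a) - (b - a) * c) {a..b}"
      using has_integral_diff[OF poisson_has_integral[OF r that(1)] has_integral_const_real[of c a b]] that(1)
      by simp
    then show ?thesis by (rule has_integral_eq[rotated]) (use ge that(2) in auto)
  qed
  have minus: "((\<lambda>t. \<bar>poisson r t - c\<bar>) has_integral
      (b - a) * c - (poisson_primitive r b - poisson_primitive r a)) {a..b}"
    if "a \<le> b" "\<And>t. t \<in> {a..b} \<Longrightarrow> cos t \<le> 0" for a b
  proof -
    have "((\<lambda>t. c - poisson r t) has_integral (b - a) * c - (poisson_primitive r b - poisson_primitive r a)) {a..b}"
      using has_integral_diff[OF has_integral_const_real[of c a b] poisson_has_integral[OF r that(1)]] that(1)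
      by simp
    then show ?thesis by (rule has_integral_eq[rotated]) (use le that(2) in auto)
  qed
  have 1: "((\<lambda>t. \<bar>poisson r t - c\<bar>) has_integral
      (poisson_primitive r (pi / 2) - poisson_primitive r 0) - (pi / 2 - 0) * c) {0..pi / 2}"
    by (intro plus cos_ge_zero) auto
  have 2: "((\<lambda>t. \<bar>poisson r t - c\<bar>) has_integral
      (3 * pi / 2 - pi / 2) * c - (poisson_primitive r (3 * pi / 2) - poisson_primitive r (pi / 2))) {pi / 2..3 * pi / 2}"
  proof (rule minus)
    fix t assume "t \<in> {pi / 2..3 * pi / 2}"
    then have "0 \<le> cos (t - pi)" by (intro cos_ge_zero) auto
    then show "cos t \<le> 0" by simp
  qed simp
  have 3: "((\<lambda>t. \<bar>poisson r t - c\<bar>) has_integral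
      (poisson_primitive r (2 * pi) - poisson_primitive r (3 * pi / 2)) - (2 * pi - 3 * pi / 2) * c) {3 * pi / 2..2 * pi}"
  proof (rule plus)
    fix t assume "t \<in> {3 * pi / 2..2 * pi}"
    then have "0 \<le> cos (t - 2 * pi)" by (intro cos_ge_zero) auto
    then show "0 \<le> cos t" by (simp add: cos_diff)
  qed simp
  have "((\<lambda>t. \<bar>poisson r t - c\<bar>) has_integral
      (((poisson_primitive r (pi / 2) - poisson_primitive r 0) - (pi / 2 - 0) * c)
      + ((3 * pi / 2 - pi / 2) * c - (poisson_primitive r (3 * pi / 2) - poisson_primitive r (pi / 2))))
      + ((poisson_primitive r (2 * pi) - poisson_primitive r (3 * pi / 2)) - (2 * pi - 3 * pi / 2) * c)) {0..2 * pi}"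
    by (rule has_integral_combine[OF _ _ has_integral_combine[OF _ _ 1 2] 3]) simp_all
  also have "(((poisson_primitive r (pi / 2) - poisson_primitive r 0) - (pi / 2 - 0) * c)
      + ((3 * pi / 2 - pi / 2) * c - (poisson_primitive r (3 * pi / 2) - poisson_primitive r (pi / 2))))
      + ((poisson_primitive r (2 * pi) - poisson_primitive r (3 * pi / 2)) - (2 * pi - 3 * pi / 2) * c) = 8 * arctan r"
    unfolding poisson_primitive_values by (simp add: field_simps)
  finally show ?thesis by (simp only: c_def)
qed

lemma cmod_one_minus_cis:
  "(cmod (1 - of_real r * cis t))\<^sup>2 = 1 - 2 * r * cos t + r\<^sup>2"
  unfolding cmod_power2
  by (simp add: power_mult_distrib power2_diff sin_squared_eq algebra_simps)

lemma alpha_kernel_cis: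
  assumes r: "0 \<le> r" "r < 1"
  shows "alpha_kernel \<alpha> r (cis t) =
    of_real ((1 - r\<^sup>2) powr \<alpha>) * (1 - of_real r * cis t) powr (- of_real \<alpha>) * of_real (poisson r t)"
proof -
  define w where "w = 1 - of_real r * cis t"
  have w0: "w \<noteq> 0" unfolding w_def using r by (intro sphere_denominators) auto
  have r2: "0 < 1 - r\<^sup>2" using r by (simp add: abs_square_less_1)
  have "w powr (- of_real (\<alpha> + 1)) = w powr (- of_real \<alpha> - 1)" by simp
  also have "\<dots> = w powr (- of_real \<alpha>) / w" using w0 by (subst powr_diff) simp
  finally have "alpha_kernel \<alpha> r (cis t) = of_real ((1 - r\<^sup>2) powr (\<alpha> + 1)) * w powr (- of_real \<alpha>) / (w * cnj w)"
    by (simp add: alpha_kernel_def w_def)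
  also have "w * cnj w = of_real (1 - 2 * r * cos t + r\<^sup>2)"
    by (simp only: complex_norm_square[symmetric] w_def cmod_one_minus_cis)
  also have "(1 - r\<^sup>2) powr (\<alpha> + 1) = (1 - r\<^sup>2) powr \<alpha> * (1 - r\<^sup>2)"
    using r2 by (simp add: powr_add)
  finally show ?thesis by (simp only: w_def poisson_def of_real_mult of_real_divide times_divide_eq_right mult_ac)
qed

text \<open>Along the radius from \<open>0\<close> to \<open>r \<zeta>\<close> the derivative of \<open>(1 - s \<zeta>)\<^bsup>-\<alpha>\<^esup>\<close> has modulus
  \<open>|\<alpha>| |1 - s \<zeta>|\<^bsup>-\<alpha> - 1\<^esup>\<close>. The exponent is negative because \<open>\<alpha> > -1\<close>, so this is largest for \<open>\<zeta> = 1\<close>,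
  where the derivative has constant sign and integrates to the right-hand side.\<close>

lemma powr_minus_one_bound:
  assumes \<alpha>: "\<alpha> > -1" and r: "0 \<le> r" "r < 1" and \<zeta>: "cmod \<zeta> = 1"
  shows "cmod ((1 - of_real r * \<zeta>) powr (- of_real \<alpha>) - 1) \<le> sgn \<alpha> * ((1 - r) powr (- \<alpha>) - 1)"
proof (cases "r = 0")
  case False
  let ?f = "\<lambda>s::real. (1 - of_real s * \<zeta>) powr (- of_real \<alpha>)"
  let ?\<phi> = "\<lambda>s::real. sgn \<alpha> * (1 - s) powr (- \<alpha>)"
  have f': "(?f has_vector_derivative of_real \<alpha> * \<zeta> * (1 - of_real s * \<zeta>) powr (- of_real \<alpha> - 1)) (at s)"
    if "0 \<le> s" "s < 1" for s
  proof -
    have "((\<lambda>s::real. 1 - of_real s * \<zeta>) has_vector_derivative - \<zeta>) (at s)"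
      by (auto intro!: derivative_eq_intros simp: has_vector_derivative_def scaleR_conv_of_real)
    from field_vector_diff_chain_at[OF this has_field_derivative_powr[of _ "- of_real \<alpha>"]]
    show ?thesis using sphere_denominators(3)[OF that \<zeta>] by (simp add: o_def mult_ac)
  qed
  have \<phi>': "(?\<phi> has_vector_derivative \<bar>\<alpha>\<bar> * (1 - s) powr (- \<alpha> - 1)) (at s)" if "s < 1" for s
    unfolding has_real_derivative_iff_has_vector_derivative[symmetric]
    using that by (auto intro!: derivative_eq_intros simp: abs_sgn mult_ac)
  have "cmod (?f r - ?f 0) \<le> ?\<phi> r - ?\<phi> 0"
  proof (rule differentiable_bound_general)
    show "0 < r" using r False by simp
    show "continuous_on {0..r} ?f"
      using r by (intro continuous_at_imp_continuous_on ballI has_vector_derivative_continuous[OF f']) auto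
    show "continuous_on {0..r} ?\<phi>"
      using r by (intro continuous_at_imp_continuous_on ballI has_vector_derivative_continuous[OF \<phi>']) auto
    fix s assume s: "0 < s" "s < r"
    show "(?f has_vector_derivative of_real \<alpha> * \<zeta> * (1 - of_real s * \<zeta>) powr (- of_real \<alpha> - 1)) (at s)"
      using s r by (intro f') auto
    show "(?\<phi> has_vector_derivative \<bar>\<alpha>\<bar> * (1 - s) powr (- \<alpha> - 1)) (at s)"
      using s r by (intro \<phi>') auto
    have "1 - s \<le> cmod (1 - of_real s * \<zeta>)"
      using norm_triangle_ineq2[of 1 "of_real s * \<zeta>"] \<zeta> s by (simp add: norm_mult)
    then have "cmod (1 - of_real s * \<zeta>) powr (- \<alpha> - 1) \<le> (1 - s) powr (- \<alpha> - 1)"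
      using \<alpha> s r by (intro powr_mono2') auto
    moreover have "cmod ((1 - of_real s * \<zeta>) powr (- of_real \<alpha> - 1)) = cmod (1 - of_real s * \<zeta>) powr (- \<alpha> - 1)"
      using norm_powr_real_powr'[of "- of_real \<alpha> - 1"] by simp
    ultimately show "cmod (of_real \<alpha> * \<zeta> * (1 - of_real s * \<zeta>) powr (- of_real \<alpha> - 1)) \<le> \<bar>\<alpha>\<bar> * (1 - s) powr (- \<alpha> - 1)"
      by (simp add: norm_mult \<zeta> mult_left_mono)
  qed
  then show ?thesis by (simp add: right_diff_distrib)
qed auto

lemma weight_factor:
  assumes "0 \<le> r" "r < (1::real)"
  shows "(1 - r\<^sup>2) powr \<alpha> = (1 - r) powr \<alpha> * (1 + r) powr \<alpha>"
proof -
  have "1 - r\<^sup>2 = (1 - r) * (1 + r)" by (simp add: power2_eq_square algebra_simps)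
  then show ?thesis using assms by (simp add: powr_mult)
qed

text \<open>Here the factor \<open>(1 - r\<^sup>2)\<^sup>\<alpha> (1 - r \<zeta>)\<^bsup>-\<alpha>\<^esup>\<close>, of modulus at most \<open>2\<^sup>\<alpha>\<close>, stays with the deviation of
  the Poisson kernel, and its own deviation from \<open>(1 - r\<^sup>2)\<^sup>\<alpha>\<close> is multiplied by the constant
  \<open>(1 - r\<^sup>2) / (1 + r\<^sup>2)\<close>. This constant provides the factor \<open>1 - r\<close> of the second term.\<close>

lemma alpha_kernel_deviation_nonneg:
  assumes \<alpha>: "\<alpha> \<ge> 0" and r: "0 \<le> r" "r < 1"
  shows "cmod (alpha_kernel \<alpha> r (cis t) - of_real ((1 - r\<^sup>2) powr (\<alpha> + 1) / (1 + r\<^sup>2)))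
    \<le> 2 powr \<alpha> * \<bar>poisson r t - (1 - r\<^sup>2) / (1 + r\<^sup>2)\<bar>
      + 2 powr (\<alpha> + 1) * (1 - r) * (1 - (1 - r) powr \<alpha>)"
proof -
  define w where "w = (1 - r\<^sup>2) powr \<alpha>"
  define c where "c = (1 - r\<^sup>2) / (1 + r\<^sup>2)"
  define p where "p = poisson r t"
  define G where "G = (1 - of_real r * cis t) powr (- of_real \<alpha>)"
  have r2: "0 < 1 - r\<^sup>2" using r by (simp add: abs_square_less_1)
  have w: "w = (1 - r) powr \<alpha> * (1 + r) powr \<alpha>" "w \<ge> 0"
    unfolding w_def using weight_factor[OF r] by auto
  have c: "c \<ge> 0" using r2 by (simp add: c_def)
  have inv: "(1 - r) powr \<alpha> * (1 - r) powr (- \<alpha>) = 1" using r by (simp flip: powr_add)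
  have wc: "(1 - r\<^sup>2) powr (\<alpha> + 1) / (1 + r\<^sup>2) = w * c"
    using r2 by (simp add: w_def c_def powr_add)
  have G: "w * cmod G \<le> 2 powr \<alpha>"
  proof -
    have "1 - r \<le> cmod (1 - of_real r * cis t)"
      using norm_triangle_ineq2[of 1 "of_real r * cis t"] r by (simp add: norm_mult)
    then have "cmod (1 - of_real r * cis t) powr (- \<alpha>) \<le> (1 - r) powr (- \<alpha>)"
      using \<alpha> r by (intro powr_mono2') auto
    then have "cmod G \<le> (1 - r) powr (- \<alpha>)"
      using norm_powr_real_powr'[of "- of_real \<alpha>"] by (simp add: G_def)
    then have "w * cmod G \<le> w * (1 - r) powr (- \<alpha>)" using w(2) by (rule mult_left_mono)
    also have "\<dots> = (1 + r) powr \<alpha>" using inv by (simp add: w(1) mult.commute mult.left_commute)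
    also have "\<dots> \<le> 2 powr \<alpha>" using \<alpha> r by (intro powr_mono2) auto
    finally show ?thesis .
  qed
  have G1: "w * cmod (G - 1) * c \<le> 2 powr (\<alpha> + 1) * (1 - r) * (1 - (1 - r) powr \<alpha>)"
  proof -
    have "cmod (G - 1) \<le> (1 - r) powr (- \<alpha>) - 1"
    proof (cases "\<alpha> = 0")
      case False
      then show ?thesis using powr_minus_one_bound[of \<alpha> r "cis t"] \<alpha> r by (simp add: G_def)
    qed (use r sphere_denominators(1)[OF r, of "cis t"] in \<open>simp add: G_def\<close>)
    then have "w * cmod (G - 1) * c \<le> w * ((1 - r) powr (- \<alpha>) - 1) * c"
      using w(2) c by (intro mult_right_mono mult_left_mono)
    also have "w * ((1 - r) powr (- \<alpha>) - 1) = (1 + r) powr \<alpha> * (1 - (1 - r) powr \<alpha>)"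
      using inv by (simp add: w(1) algebra_simps)
    also have "(1 + r) powr \<alpha> * (1 - (1 - r) powr \<alpha>) * c
        = (1 + r) powr (\<alpha> + 1) / (1 + r\<^sup>2) * ((1 - r) * (1 - (1 - r) powr \<alpha>))"
    proof -
      have "c = (1 + r) * (1 - r) / (1 + r\<^sup>2)"
        by (simp add: c_def power2_eq_square algebra_simps)
      then show ?thesis using r by (simp add: powr_add)
    qed
    also have "\<dots> \<le> 2 powr (\<alpha> + 1) * ((1 - r) * (1 - (1 - r) powr \<alpha>))"
    proof (rule mult_right_mono)
      have "(1 + r) powr (\<alpha> + 1) / (1 + r\<^sup>2) \<le> 2 powr (\<alpha> + 1) / 1"
        using \<alpha> r by (intro frac_le powr_mono2) auto
      then show "(1 + r) powr (\<alpha> + 1) / (1 + r\<^sup>2) \<le> 2 powr (\<alpha> + 1)" by simp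
      show "0 \<le> (1 - r) * (1 - (1 - r) powr \<alpha>)"
        using \<alpha> r by (intro mult_nonneg_nonneg) (auto intro!: powr_le1)
    qed
    finally show ?thesis by (simp add: mult.assoc)
  qed
  have "alpha_kernel \<alpha> r (cis t) - of_real (w * c) = of_real w * G * of_real (p - c) + of_real w * (G - 1) * of_real c"
    unfolding alpha_kernel_cis[OF r] by (simp add: w_def G_def p_def algebra_simps)
  also have "cmod \<dots> \<le> w * cmod G * \<bar>p - c\<bar> + w * cmod (G - 1) * c"
    using norm_triangle_ineq[of "of_real w * G * of_real (p - c)" "of_real w * (G - 1) * of_real c"] w(2) c
    unfolding norm_mult norm_of_real by simp
  also have "\<dots> \<le> 2 powr \<alpha> * \<bar>p - c\<bar> + 2 powr (\<alpha> + 1) * (1 - r) * (1 - (1 - r) powr \<alpha>)"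
    by (intro add_mono mult_right_mono G G1) auto
  finally show ?thesis by (simp add: wc p_def c_def)
qed

text \<open>Here the deviation of \<open>(1 - r \<zeta>)\<^bsup>-\<alpha>\<^esup>\<close> from \<open>1\<close> is multiplied by the Poisson kernel, whose mean is \<open>1\<close>,
  and the deviation of the Poisson kernel only by \<open>(1 - r\<^sup>2)\<^sup>\<alpha> \<le> (1 - r)\<^sup>\<alpha>\<close>.\<close>

lemma alpha_kernel_deviation_neg:
  assumes \<alpha>: "-1 < \<alpha>" "\<alpha> < 0" and r: "0 \<le> r" "r < 1"
  shows "cmod (alpha_kernel \<alpha> r (cis t) - of_real ((1 - r\<^sup>2) powr (\<alpha> + 1) / (1 + r\<^sup>2)))
    \<le> (1 - r) powr \<alpha> * \<bar>poisson r t - (1 - r\<^sup>2) / (1 + r\<^sup>2)\<bar> + ((1 - r) powr \<alpha> - 1) * poisson r t"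
proof -
  define w where "w = (1 - r\<^sup>2) powr \<alpha>"
  define c where "c = (1 - r\<^sup>2) / (1 + r\<^sup>2)"
  define p where "p = poisson r t"
  define G where "G = (1 - of_real r * cis t) powr (- of_real \<alpha>)"
  have r2: "0 < 1 - r\<^sup>2" using r by (simp add: abs_square_less_1)
  have p: "p \<ge> 0" using r2 poisson_denominator[OF r, of t] by (simp add: p_def poisson_def)
  have inv: "(1 - r) powr \<alpha> * (1 - r) powr (- \<alpha>) = 1" using r by (simp flip: powr_add)
  have w: "w \<le> (1 - r) powr \<alpha>" "w \<ge> 0"
  proof -
    have "r\<^sup>2 \<le> r" using r by (simp add: power2_eq_square mult_left_le)
    then show "w \<le> (1 - r) powr \<alpha>" unfolding w_def using \<alpha> r by (intro powr_mono2') auto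
  qed (simp add: w_def)
  have wc: "(1 - r\<^sup>2) powr (\<alpha> + 1) / (1 + r\<^sup>2) = w * c"
    using r2 by (simp add: w_def c_def powr_add)
  have "cmod (G - 1) \<le> 1 - (1 - r) powr (- \<alpha>)"
    using powr_minus_one_bound[of \<alpha> r "cis t"] \<alpha> r by (simp add: G_def)
  then have "w * cmod (G - 1) \<le> (1 - r) powr \<alpha> * (1 - (1 - r) powr (- \<alpha>))"
    using w by (intro mult_mono) auto
  then have G1: "w * cmod (G - 1) \<le> (1 - r) powr \<alpha> - 1" using inv by (simp add: right_diff_distrib)
  have "alpha_kernel \<alpha> r (cis t) - of_real (w * c) = of_real (w * (p - c)) + of_real w * (G - 1) * of_real p"
    unfolding alpha_kernel_cis[OF r] by (simp add: w_def G_def p_def algebra_simps)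
  also have "cmod \<dots> \<le> w * \<bar>p - c\<bar> + w * cmod (G - 1) * p"
    using norm_triangle_ineq[of "of_real (w * (p - c))" "of_real w * (G - 1) * of_real p"] w(2) p
    unfolding norm_mult norm_of_real abs_mult by simp
  also have "\<dots> \<le> (1 - r) powr \<alpha> * \<bar>p - c\<bar> + ((1 - r) powr \<alpha> - 1) * p"
    by (intro add_mono mult_right_mono w(1) G1 p) auto
  finally show ?thesis by (simp add: wc p_def c_def)
qed

text \<open>For every \<open>\<rho> < 1\<close> the difference of the means is the mean of the kernel minus \<open>c\<close> against a function bounded by
  \<open>1\<close>. The bound does not depend on \<open>\<rho>\<close> and survives the limit.\<close>

lemma expansion_deviation_le:
  assumes E: "has_expansion \<alpha> f H \<beta>" and \<alpha>: "\<alpha> > -1" and f: "f ` ball 0 1 \<subseteq> ball 0 1"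
    and r: "0 < r" "r < 1" and b: "(b has_integral I) {0..2 * pi}"
    and le: "\<And>t. cmod (alpha_kernel \<alpha> r (cis t) - of_real c) \<le> b t"
  shows "cmod (f (of_real r) - of_real c * f 0) \<le> I / (2 * pi)"
proof (rule tendsto_upperbound)
  show "((\<lambda>\<rho>. cmod (circle_mean (\<lambda>\<zeta>. alpha_kernel \<alpha> r \<zeta> * f (of_real \<rho> * \<zeta>)) - of_real c * f 0)) \<longlongrightarrow>
      cmod (f (of_real r) - of_real c * f 0)) (at_left 1)"
    by (intro tendsto_intros expansion_poisson_limit[OF E \<alpha> r])
  have "cmod (circle_mean (\<lambda>\<zeta>. alpha_kernel \<alpha> r \<zeta> * f (of_real \<rho> * \<zeta>)) - of_real c * f 0) \<le> I / (2 * pi)"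
    if \<rho>: "0 < \<rho>" "\<rho> < 1" for \<rho>
  proof -
    have contf: "continuous_on (sphere 0 1) (\<lambda>\<zeta>. f (of_real \<rho> * \<zeta>))"
      using E \<rho> by (intro continuous_on_dilated) (auto simp: has_expansion_def)
    have contK: "continuous_on (sphere 0 1) (alpha_kernel \<alpha> r)"
      using r by (intro alpha_kernel_continuous) auto
    have "of_real c * f 0 = circle_mean (\<lambda>\<zeta>. of_real c * f (of_real \<rho> * \<zeta>))"
      using expansion_mean_value[OF E, of \<rho>] \<rho> by (simp add: circle_mean_mult)
    then have "circle_mean (\<lambda>\<zeta>. alpha_kernel \<alpha> r \<zeta> * f (of_real \<rho> * \<zeta>)) - of_real c * f 0
        = circle_mean (\<lambda>\<zeta>. alpha_kernel \<alpha> r \<zeta> * f (of_real \<rho> * \<zeta>) - of_real c * f (of_real \<rho> * \<zeta>))"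
      by (simp only:) (intro circle_mean_diff[symmetric] continuous_on_mult continuous_on_const contf contK)
    also have "cmod \<dots> \<le> I / (2 * pi)"
    proof (rule circle_mean_norm_le[OF _ b])
      fix t
      have "of_real \<rho> * cis t \<in> ball 0 1" using \<rho> by (simp add: norm_mult)
      then have "cmod (f (of_real \<rho> * cis t)) \<le> 1" using f by force
      then have "cmod (alpha_kernel \<alpha> r (cis t) - of_real c) * cmod (f (of_real \<rho> * cis t)) \<le> b t * 1"
        using order_trans[OF norm_ge_zero le] by (intro mult_mono le) auto
      then show "cmod (alpha_kernel \<alpha> r (cis t) * f (of_real \<rho> * cis t) - of_real c * f (of_real \<rho> * cis t)) \<le> b t"
        by (simp flip: norm_mult left_diff_distrib)
    qed (intro continuous_on_diff continuous_on_mult continuous_on_const contf contK)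
    finally show ?thesis .
  qed
  then show "\<forall>\<^sub>F \<rho> in at_left 1. cmod (circle_mean (\<lambda>\<zeta>. alpha_kernel \<alpha> r \<zeta> * f (of_real \<rho> * \<zeta>)) - of_real c * f 0) \<le> I / (2 * pi)"
    using eventually_at_left_real[of 0 1] by (auto elim: eventually_mono)
qed simp

theorem theorem3p1:
  fixes \<alpha> :: real and f :: "complex \<Rightarrow> complex"
  assumes "\<alpha> > -1"
    and "f ` ball 0 1 \<subseteq> ball 0 1"
    and "alpha_harmonic \<alpha> f"
  shows "\<forall>z\<in>ball 0 1.
     (\<alpha> \<ge> 0 \<longrightarrow>
        cmod (f z - of_real ((1 - (cmod z)\<^sup>2) powr (\<alpha> + 1) / (1 + (cmod z)\<^sup>2)) * f 0)
          \<le> 2 powr (\<alpha> + 2) / pi * arctan (cmod z)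
             + 2 powr (\<alpha> + 1) * (1 - cmod z) * (1 - (1 - cmod z) powr \<alpha>)) \<and>
     (\<alpha> < 0 \<longrightarrow>
        cmod (f z - of_real ((1 - (cmod z)\<^sup>2) powr (\<alpha> + 1) / (1 + (cmod z)\<^sup>2)) * f 0)
          \<le> 4 / pi * (1 - cmod z) powr \<alpha> * arctan (cmod z)
             + ((1 - cmod z) powr \<alpha> - 1))"
proof
  fix z :: complex assume z: "z \<in> ball 0 1"
  show "(\<alpha> \<ge> 0 \<longrightarrow>
        cmod (f z - of_real ((1 - (cmod z)\<^sup>2) powr (\<alpha> + 1) / (1 + (cmod z)\<^sup>2)) * f 0)
          \<le> 2 powr (\<alpha> + 2) / pi * arctan (cmod z)
             + 2 powr (\<alpha> + 1) * (1 - cmod z) * (1 - (1 - cmod z) powr \<alpha>)) \<and>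
     (\<alpha> < 0 \<longrightarrow>
        cmod (f z - of_real ((1 - (cmod z)\<^sup>2) powr (\<alpha> + 1) / (1 + (cmod z)\<^sup>2)) * f 0)
          \<le> 4 / pi * (1 - cmod z) powr \<alpha> * arctan (cmod z)
             + ((1 - cmod z) powr \<alpha> - 1))"
  proof (cases "z = 0")
    case True
    then show ?thesis by simp
  next
    case False
    define r where "r = cmod z"
    define u where "u = sgn z"
    define c where "c = (1 - r\<^sup>2) powr (\<alpha> + 1) / (1 + r\<^sup>2)"
    have r: "0 < r" "r < 1" using z False by (auto simp: r_def)
    have u: "cmod u = 1" using False by (simp add: u_def norm_sgn)
    have z_eq: "z = u * of_real r" using False by (simp add: u_def r_def sgn_eq)
    obtain H \<beta> where "has_expansion \<alpha> f H \<beta>"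
      by (rule alpha_harmonic_has_expansion[OF assms(3)])
    from has_expansion_rotate[OF this u]
    have E: "has_expansion \<alpha> (\<lambda>z. f (u * z)) (\<lambda>z. H (u * z)) (\<lambda>n. \<beta> n * cnj u ^ Suc n)" .
    have "(\<lambda>z. f (u * z)) ` ball 0 1 \<subseteq> ball 0 1"
      using assms(2) u by (auto simp: norm_mult image_subset_iff)
    note bound = expansion_deviation_le[OF E assms(1) this r, of _ _ c, folded z_eq]
    note D = poisson_deviation_integral[OF less_imp_le[OF r(1)] r(2)]
    have P: "(poisson r has_integral 2 * pi) {0..2 * pi}"
      using poisson_has_integral[of r 0 "2 * pi"] r by (simp add: poisson_primitive_values)
    show ?thesis
    proof (intro conjI impI)
      assume \<alpha>: "\<alpha> \<ge> 0"
      define k where "k = 2 powr (\<alpha> + 1) * (1 - r) * (1 - (1 - r) powr \<alpha>)"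
      have "cmod (f z - of_real c * f (u * 0)) \<le> (2 powr \<alpha> * (8 * arctan r) + (2 * pi - 0) * k) / (2 * pi)"
      proof (rule bound)
        show "((\<lambda>t. 2 powr \<alpha> * \<bar>poisson r t - (1 - r\<^sup>2) / (1 + r\<^sup>2)\<bar> + k) has_integral
            2 powr \<alpha> * (8 * arctan r) + (2 * pi - 0) * k) {0..2 * pi}"
          using has_integral_const_real[of k 0 "2 * pi"]
          by (intro has_integral_add has_integral_mult_right D) auto
        show "cmod (alpha_kernel \<alpha> r (cis t) - of_real c) \<le> 2 powr \<alpha> * \<bar>poisson r t - (1 - r\<^sup>2) / (1 + r\<^sup>2)\<bar> + k" for t
          unfolding c_def k_def using \<alpha> r by (intro alpha_kernel_deviation_nonneg) auto
      qed
      also have "\<dots> = 2 powr (\<alpha> + 2) / pi * arctan r + k"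
        by (simp add: powr_add field_simps)
      finally show "cmod (f z - of_real ((1 - (cmod z)\<^sup>2) powr (\<alpha> + 1) / (1 + (cmod z)\<^sup>2)) * f 0)
          \<le> 2 powr (\<alpha> + 2) / pi * arctan (cmod z)
             + 2 powr (\<alpha> + 1) * (1 - cmod z) * (1 - (1 - cmod z) powr \<alpha>)"
        by (simp only: c_def k_def r_def mult_zero_right)
    next
      assume \<alpha>: "\<alpha> < 0"
      define k where "k = (1 - r) powr \<alpha>"
      have "cmod (f z - of_real c * f (u * 0)) \<le> (k * (8 * arctan r) + (k - 1) * (2 * pi)) / (2 * pi)"
      proof (rule bound)
        show "((\<lambda>t. k * \<bar>poisson r t - (1 - r\<^sup>2) / (1 + r\<^sup>2)\<bar> + (k - 1) * poisson r t) has_integral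
            k * (8 * arctan r) + (k - 1) * (2 * pi)) {0..2 * pi}"
          by (intro has_integral_add has_integral_mult_right D P)
        show "cmod (alpha_kernel \<alpha> r (cis t) - of_real c) \<le>
            k * \<bar>poisson r t - (1 - r\<^sup>2) / (1 + r\<^sup>2)\<bar> + (k - 1) * poisson r t" for t
          unfolding c_def k_def using \<alpha> r assms(1) by (intro alpha_kernel_deviation_neg) auto
      qed
      also have "\<dots> = 4 / pi * k * arctan r + (k - 1)"
        by (simp add: field_simps)
      finally show "cmod (f z - of_real ((1 - (cmod z)\<^sup>2) powr (\<alpha> + 1) / (1 + (cmod z)\<^sup>2)) * f 0)
          \<le> 4 / pi * (1 - cmod z) powr \<alpha> * arctan (cmod z) + ((1 - cmod z) powr \<alpha> - 1)"
        by (simp only: c_def k_def r_def mult_zero_right)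
    qed
  qed
qed

end
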